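(* Let $d\geq 1$ be an integer and let $L:\mathbb C^{d\times d}\to\mathbb C^{d\times d}$ be a complex-linear map such that $e^{tL}$ is 2-positive and trace-preserving for all $t\geq 0$. Then $$\mathrm{tr}(L)\leq d\,\min\Re(\sigma(L)).$$ Equivalently, if $\lambda_1,\ldots,\lambda_{d^2}$ are the eigenvalues of $L$ counted with algebraic multiplicity and $\Gamma_j:=-\Re(\lambda_j)$, then for all $j\in\{1,\ldots,d^2\}$ $$\Gamma_j\leq\frac1d\sum_{k=1}^{d^2}\Gamma_k.$$
   Context: $\mathbb C^{d\times d}$ is the space of complex $d\times d$ matrices. A linear map $\Phi:\mathbb C^{d\times d}\to\mathbb C^{d\times d}$ is positive if $\Phi(A)$ is positive semi-definite whenever $A$ is positive semi-definite. It is 2-positive if the extended map $\mathrm{id}_2\otimes\Phi:\mathbb C^{2\times 2}\otimes\mathbb C^{d\times d}\to\mathbb C^{2\times 2}\otimes\mathbb C^{d\times d}$, determined by $(\mathrm{id}_2\otimes\Phi)(A\otimes B)=A\otimes\Phi(B)$, is positive (sends positive semi-definite matrices to positive semi-definite matrices). It is trace-preserving if $\mathrm{tr}(\Phi(X))=\mathrm{tr}(X)$ for all $X\in\mathbb C^{d\times d}$. $e^{tL}$ is the exponential of the linear operator $tL$ on the $d^2$-dimensional complex vector space $\mathbb C^{d\times d}$. $\mathrm{tr}(L)$ is the trace of $L$ as a linear operator on that space (it is real for $L$ as in the statement), $\sigma(L)$ is its spectrum, and $\min\Re(\sigma(L))$ is the smallest real part of any eigenvalue of $L$. *)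

theory Defs
  imports
    "HOL-Analysis.Analysis"
    "HOL-Computational_Algebra.Fundamental_Theorem_Algebra"
begin

text \<open>
  The space of complex \<open>d \<times> d\<close> matrices is \<^typ>\<open>complex^'n^'n\<close> with \<open>d = CARD('n)\<close>. The library's
  \<open>(*s)\<close> on this type does not scale by complex numbers, so the complex scalar multiplication is
  introduced here.
\<close>

definition mscale :: "complex \<Rightarrow> complex^'m^'n \<Rightarrow> complex^'m^'n"
  where "mscale c A = (\<chi> i j. c * A $ i $ j)"

lemma vector_space_mscale: "vector_space (mscale :: complex \<Rightarrow> complex^'m^'n \<Rightarrow> _)"
  by standard (simp_all add: mscale_def vec_eq_iff algebra_simps)

definition complex_linear :: "(complex^'n^'n \<Rightarrow> complex^'n^'n) \<Rightarrow> bool"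
  where "complex_linear = Vector_Spaces.linear mscale mscale"

lemma complex_linear_iff:
  "complex_linear L \<longleftrightarrow>
     (\<forall>X Y. L (X + Y) = L X + L Y) \<and> (\<forall>c X. L (mscale c X) = mscale c (L X))"
  by (auto simp: complex_linear_def Vector_Spaces.linear_def module_hom_def module_hom_axioms_def
      vector_space_mscale vector_space.vector_space_assms module_iff_vector_space)


subsection \<open>Positivity\<close>

definition pos_semidef :: "complex^'n^'n \<Rightarrow> bool"
  where "pos_semidef A \<longleftrightarrow>
    (\<forall>i j. A $ i $ j = cnj (A $ j $ i)) \<and>
    (\<forall>x :: complex^'n. 0 \<le> Re (\<Sum>i\<in>UNIV. \<Sum>j\<in>UNIV. cnj (x $ i) * A $ i $ j * x $ j))"

definition positive_map :: "(complex^'n^'n \<Rightarrow> complex^'n^'n) \<Rightarrow> bool"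
  where "positive_map \<Phi> \<longleftrightarrow> (\<forall>A. pos_semidef A \<longrightarrow> pos_semidef (\<Phi> A))"

text \<open>
  The tensor product of the \<open>k \<times> k\<close> and the \<open>d \<times> d\<close> matrices is the space of matrices indexed by
  pairs, with the Kronecker product as the tensor map; \<open>id \<otimes> \<Phi>\<close> then applies \<open>\<Phi>\<close> to each of the
  \<open>k\<^sup>2\<close> blocks.
\<close>

definition kronecker :: "complex^'k^'k \<Rightarrow> complex^'n^'n \<Rightarrow> complex^('k::finite \<times> 'n::finite)^('k \<times> 'n)"
  where "kronecker A B = (\<chi> p q. A $ fst p $ fst q * B $ snd p $ snd q)"

definition id_tensor ::
    "(complex^'n^'n \<Rightarrow> complex^'n^'n) \<Rightarrow>
      complex^('k::finite \<times> 'n::finite)^('k \<times> 'n) \<Rightarrow> complex^('k \<times> 'n)^('k \<times> 'n)"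
  where "id_tensor \<Phi> M =
    (\<chi> p q. \<Phi> (\<chi> i j. M $ (fst p, i) $ (fst q, j)) $ snd p $ snd q)"

lemma id_tensor_kronecker:
  assumes "complex_linear \<Phi>"
  shows "id_tensor \<Phi> (kronecker A B) = kronecker A (\<Phi> B)"
proof -
  have "\<Phi> (\<chi> i j. A $ a $ b * B $ i $ j) = mscale (A $ a $ b) (\<Phi> B)" for a b
    using assms by (simp add: complex_linear_iff flip: mscale_def)
  then show ?thesis
    by (simp add: id_tensor_def kronecker_def vec_eq_iff mscale_def)
qed

definition two_positive :: "(complex^'n^'n \<Rightarrow> complex^'n^'n) \<Rightarrow> bool"
  where "two_positive \<Phi> \<longleftrightarrow>
    positive_map (id_tensor \<Phi> :: complex^(2 \<times> 'n)^(2 \<times> 'n) \<Rightarrow> complex^(2 \<times> 'n)^(2 \<times> 'n))"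

definition trace_preserving :: "(complex^'n^'n \<Rightarrow> complex^'n^'n) \<Rightarrow> bool"
  where "trace_preserving \<Phi> \<longleftrightarrow> (\<forall>X. trace (\<Phi> X) = trace X)"


subsection \<open>Exponential of an operator\<close>

definition op_exp :: "('a::real_normed_vector \<Rightarrow> 'a) \<Rightarrow> 'a \<Rightarrow> 'a"
  where "op_exp A X = (\<Sum>n. (A ^^ n) X /\<^sub>R fact n)"

lemma op_exp_sums:
  fixes A :: "'a::banach \<Rightarrow> 'a"
  assumes "bounded_linear A"
  shows "(\<lambda>n. (A ^^ n) X /\<^sub>R fact n) sums op_exp A X"
proof -
  obtain K where K: "\<And>x. norm (A x) \<le> norm x * K" "0 < K"
    using bounded_linear.pos_bounded[OF assms] by blast
  have bound: "norm ((A ^^ n) X) \<le> norm X * K ^ n" for n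
  proof (induction n)
    case (Suc n)
    have "norm ((A ^^ Suc n) X) \<le> norm ((A ^^ n) X) * K" using K(1) by simp
    also have "\<dots> \<le> (norm X * K ^ n) * K" using Suc K(2) by (intro mult_right_mono) auto
    finally show ?case by (simp add: algebra_simps)
  qed simp
  have "summable (\<lambda>n. norm X * (K ^ n /\<^sub>R fact n))"
    by (intro summable_mult summable_exp_generic)
  then have "summable (\<lambda>n. (A ^^ n) X /\<^sub>R fact n)"
  proof (rule summable_comparison_test'[of _ 0])
    show "norm ((A ^^ n) X /\<^sub>R fact n) \<le> norm X * (K ^ n /\<^sub>R fact n)" for n
      using bound[of n] by (simp add: field_simps)
  qed
  then show ?thesis by (simp add: op_exp_def summable_sums)
qed


subsection \<open>Trace, characteristic polynomial and spectrum of an operator\<close>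

definition mat_unit :: "'n::finite \<times> 'n \<Rightarrow> complex^'n^'n"
  where "mat_unit q = (\<chi> i j. if (i, j) = q then 1 else 0)"

text \<open>The \<open>d\<^sup>2 \<times> d\<^sup>2\<close> matrix representing \<open>L\<close> in the basis of matrix units.\<close>

definition op_matrix :: "(complex^'n^'n \<Rightarrow> complex^'n^'n) \<Rightarrow> complex^('n::finite \<times> 'n)^('n \<times> 'n)"
  where "op_matrix L = (\<chi> p q. L (mat_unit q) $ fst p $ snd p)"

definition op_trace :: "(complex^'n^'n \<Rightarrow> complex^'n^'n) \<Rightarrow> complex"
  where "op_trace L = trace (op_matrix L)"

definition op_charpoly :: "(complex^'n^'n \<Rightarrow> complex^'n^'n) \<Rightarrow> complex poly"
  where "op_charpoly L = det (mat [:0, 1:] - (\<chi> p q. [:op_matrix L $ p $ q:]))"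

definition op_spectrum :: "(complex^'n^'n \<Rightarrow> complex^'n^'n) \<Rightarrow> complex set"
  where "op_spectrum L = {z. \<exists>X. X \<noteq> 0 \<and> L X = mscale z X}"

definition op_eigenvalues :: "(complex^'n^'n \<Rightarrow> complex^'n^'n) \<Rightarrow> complex multiset"
  where "op_eigenvalues L = proots (op_charpoly L)"

lemma complex_linear_expand:
  assumes "complex_linear L"
  shows "L X = (\<Sum>q\<in>UNIV. mscale (X $ fst q $ snd q) (L (mat_unit q)))"
proof -
  interpret Vector_Spaces.linear mscale mscale L
    using assms by (simp add: complex_linear_def)
  have "X = (\<Sum>q\<in>UNIV. mscale (X $ fst q $ snd q) (mat_unit q))"
    by (auto simp: vec_eq_iff mscale_def mat_unit_def if_distrib sum.delta cong: if_cong)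
  then have "L X = L (\<Sum>q\<in>UNIV. mscale (X $ fst q $ snd q) (mat_unit q))" by simp
  then show ?thesis by (simp add: sum scale)
qed

lemma op_matrix_mult:
  assumes "complex_linear L"
  shows "op_matrix L *v (\<chi> p. X $ fst p $ snd p) = (\<chi> p. L X $ fst p $ snd p)"
  by (subst complex_linear_expand[OF assms, of X])
    (simp add: vec_eq_iff matrix_vector_mult_def op_matrix_def mscale_def mult.commute)

lemma poly_op_charpoly: "poly (op_charpoly L) z = det (mat z - op_matrix L)"
  unfolding op_charpoly_def det_def
  by (auto simp: poly_sum poly_prod mat_def intro!: sum.cong prod.cong)

lemma op_spectrum_eq_roots:
  fixes L :: "complex^'n^'n \<Rightarrow> complex^'n^'n"
  assumes "complex_linear L"
  shows "op_spectrum L = {z. poly (op_charpoly L) z = 0}"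
proof -
  have mv: "(mat z - op_matrix L) *v (\<chi> p. X $ fst p $ snd p)
      = (\<chi> p. (mscale z X - L X) $ fst p $ snd p)" for z X
    by (simp add: matrix_vector_mult_diff_rdistrib op_matrix_mult[OF assms])
      (simp add: vec_eq_iff matrix_vector_mult_def mat_def mscale_def if_distrib if_distribR
        sum.delta cong: if_cong)
  have eq0: "(\<chi> p. X $ fst p $ snd p) = 0 \<longleftrightarrow> X = 0" for X :: "complex^'n^'n"
    by (auto simp: vec_eq_iff)
  have "z \<in> op_spectrum L \<longleftrightarrow> (\<exists>v. v \<noteq> 0 \<and> (mat z - op_matrix L) *v v = 0)" for z
  proof
    assume "z \<in> op_spectrum L"
    then obtain X where "X \<noteq> 0" "L X = mscale z X" by (auto simp: op_spectrum_def)
    then show "\<exists>v. v \<noteq> 0 \<and> (mat z - op_matrix L) *v v = 0"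
      using mv[of z X] eq0[of X] by (intro exI[of _ "\<chi> p. X $ fst p $ snd p"]) (simp add: vec_eq_iff)
  next
    assume "\<exists>v. v \<noteq> 0 \<and> (mat z - op_matrix L) *v v = 0"
    then obtain v where v: "v \<noteq> 0" "(mat z - op_matrix L) *v v = 0" by blast
    define X :: "complex^'n^'n" where "X = (\<chi> i j. v $ (i, j))"
    have vX: "v = (\<chi> p. X $ fst p $ snd p)" by (simp add: X_def vec_eq_iff)
    have "mscale z X - L X = 0" using v(2) mv[of z X] eq0[of "mscale z X - L X"] vX by simp
    moreover have "X \<noteq> 0" using v(1) vX eq0[of X] by simp
    ultimately show "z \<in> op_spectrum L" by (auto simp: op_spectrum_def intro!: exI[of _ X])
  qed
  also have "\<dots> z \<longleftrightarrow> \<not> invertible (mat z - op_matrix L)" for z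
    by (auto simp: invertible_left_inverse matrix_left_invertible_ker)
  finally show ?thesis by (auto simp: poly_op_charpoly invertible_det_nz)
qed

lemma degree_op_charpoly:
  fixes L :: "complex^'n^'n \<Rightarrow> complex^'n^'n"
  shows "degree (op_charpoly L) = CARD('n)\<^sup>2"
proof -
  define M :: "complex poly^('n \<times> 'n)^('n \<times> 'n)"
    where "M = mat [:0, 1:] - (\<chi> p q. [:op_matrix L $ p $ q:])"
  define T where "T \<pi> = of_int (sign \<pi>) * (\<Prod>p\<in>UNIV. M $ p $ \<pi> p)" for \<pi> :: "'n \<times> 'n \<Rightarrow> 'n \<times> 'n"
  let ?P = "{\<pi>. \<pi> permutes (UNIV :: ('n \<times> 'n) set)}"
  let ?N = "CARD('n \<times> 'n)"
  have M: "M $ p $ q = (if p = q then [:- op_matrix L $ p $ q, 1:] else [:- op_matrix L $ p $ q:])" for p q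
    by (simp add: M_def mat_def)
  have Tid: "T id = (\<Prod>p\<in>UNIV. [:- op_matrix L $ p $ p, 1:])"
    by (simp add: T_def M sign_id)
  have did: "degree (T id) = ?N"
    unfolding Tid by (subst degree_prod_sum_eq) auto
  have other: "degree (T \<pi>) < ?N" if "\<pi> \<noteq> id" for \<pi>
  proof -
    obtain a where a: "\<pi> a \<noteq> a" using \<open>\<pi> \<noteq> id\<close> by (auto simp: fun_eq_iff)
    have "degree (T \<pi>) \<le> degree (\<Prod>p\<in>UNIV. M $ p $ \<pi> p)"
      unfolding T_def by (rule order_trans[OF degree_mult_le]) simp
    also have "\<dots> \<le> (\<Sum>p\<in>UNIV. degree (M $ p $ \<pi> p))"
      using degree_prod_sum_le[of UNIV "\<lambda>p. M $ p $ \<pi> p"] by (simp add: o_def)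
    also have "\<dots> < (\<Sum>p\<in>(UNIV :: ('n \<times> 'n) set). 1)"
      using a by (intro sum_strict_mono_ex1 bexI[of _ a]) (auto simp: M)
    finally show ?thesis by simp
  qed
  have fin: "finite ?P" by simp
  have "op_charpoly L = (\<Sum>\<pi>\<in>?P. T \<pi>)"
    by (simp add: op_charpoly_def det_def T_def M_def)
  also have "\<dots> = T id + (\<Sum>\<pi>\<in>?P - {id}. T \<pi>)"
    using fin by (subst sum.remove[of _ id]) (auto simp: permutes_id)
  finally have eq: "op_charpoly L = T id + (\<Sum>\<pi>\<in>?P - {id}. T \<pi>)" .
  have "degree (\<Sum>\<pi>\<in>?P - {id}. T \<pi>) < ?N"
    using other by (intro degree_sum_less) auto
  then have "degree (op_charpoly L) = ?N"
    unfolding eq using did by (simp add: degree_add_eq_left)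
  then show ?thesis by (simp add: power2_eq_square)
qed

lemma size_op_eigenvalues: "size (op_eigenvalues L) = CARD('n)\<^sup>2"
  for L :: "complex^'n^'n \<Rightarrow> complex^'n^'n"
  by (simp add: op_eigenvalues_def size_proots_complex degree_op_charpoly)

lemma op_spectrum_eq_eigenvalues:
  assumes "complex_linear L"
  shows "op_spectrum L = set_mset (op_eigenvalues L)"
proof -
  have "op_charpoly L \<noteq> 0" using degree_op_charpoly[of L] by auto
  then show ?thesis by (simp add: op_spectrum_eq_roots[OF assms] op_eigenvalues_def)
qed

lemma op_spectrum_finite_nonempty:
  assumes "complex_linear L"
  shows "finite (op_spectrum L)" and "op_spectrum L \<noteq> {}"
  using size_op_eigenvalues[of L] by (auto simp: op_spectrum_eq_eigenvalues[OF assms])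

end

theory Submission
  imports Defs
begin

text \<open>
  Let \<open>\<beta> A B = tr (L A B)\<close>, let \<open>e\<^sub>1, \<dots>, e\<^sub>d\<close> be an orthonormal basis and let \<open>t\<^sub>j\<^sub>k\<close> be the real part of
  \<open>\<beta> (e\<^sub>k e\<^sub>j\<^sup>*) (e\<^sub>j e\<^sub>k\<^sup>*)\<close>, so that the \<open>t\<^sub>j\<^sub>k\<close> add up to the trace of \<open>L\<close>. Differentiating the
  semigroup at \<open>0\<close>, 2-positivity says that the sum of \<open>\<beta> (y\<^sub>b y\<^sub>a\<^sup>*) P\<^sub>a\<^sub>b\<close> over the blocks \<open>a, b\<close> is
  nonnegative whenever \<open>P\<close> is a positive semi-definite two-by-two block matrix that annihilates
  \<open>y = (y\<^sub>1, y\<^sub>2)\<close>.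

  A left eigenvector \<open>X\<close> of \<open>L\<close> with eigenvalue \<open>\<lambda>\<close> may be shifted by a scalar, because \<open>tr (L A) = 0\<close>.
  Shifting to the nearest scalar in operator norm and rescaling, Stampfli's theorem makes \<open>X\<close> a
  contraction with \<open>X v = u\<close> for orthogonal unit vectors \<open>u, v\<close>, and then \<open>\<beta> (v u\<^sup>*) X = \<lambda>\<close>. Take
  \<open>e\<^sub>1 = u\<close> and \<open>e\<^sub>2 = v\<close>. The block matrix with diagonal blocks \<open>1 - u u\<^sup>*\<close>, \<open>1 - v v\<^sup>*\<close> and
  off-diagonal block \<open>X - u v\<^sup>*\<close> gives \<open>2 Re \<lambda> \<ge> t\<^sub>1\<^sub>1 + t\<^sub>2\<^sub>2 + 2 t\<^sub>1\<^sub>2\<close>. For \<open>j \<ge> 3\<close> the vectors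
  \<open>(u + w v, e\<^sub>j)\<close> with \<open>|w| = 1\<close>, averaged over \<open>w\<close> against an operator-valued Fejer kernel of \<open>X\<close>, give
  \<open>Re \<lambda> \<ge> 2 (t\<^sub>1\<^sub>j + t\<^sub>2\<^sub>j) - 2 t\<^sub>j\<^sub>j\<close>. Together with \<open>t\<^sub>j\<^sub>j \<le> 0\<close> and \<open>2 t\<^sub>j\<^sub>k \<le> t\<^sub>j\<^sub>j + t\<^sub>k\<^sub>k\<close> these add up to
  \<open>d Re \<lambda> \<ge> tr L\<close>. If \<open>X\<close> is itself a scalar, then \<open>\<lambda> = 0\<close> and the last two inequalities suffice.
\<close>

subsection \<open>The complex inner product\<close>

text \<open>Conjugate-linear in the first argument. Its real part is the real inner product of the
  type, so Cauchy-Schwarz and \<open>norm\<close> apply to it.\<close>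

definition cdot :: "complex^'n \<Rightarrow> complex^'n \<Rightarrow> complex"
  where "cdot x y = (\<Sum>i\<in>UNIV. cnj (x $ i) * y $ i)"

definition outer :: "complex^'n \<Rightarrow> complex^'n \<Rightarrow> complex^'n^'n"
  where "outer x y = (\<chi> i j. x $ i * cnj (y $ j))"

definition adj :: "complex^'n^'n \<Rightarrow> complex^'n^'n"
  where "adj A = (\<chi> i j. cnj (A $ j $ i))"

lemma cdot_add_left: "cdot (x + y) z = cdot x z + cdot y z"
  and cdot_add_right: "cdot x (y + z) = cdot x y + cdot x z"
  and cdot_diff_left: "cdot (x - y) z = cdot x z - cdot y z"
  and cdot_diff_right: "cdot x (y - z) = cdot x y - cdot x z"
  and cdot_scale_left: "cdot (c *s x) y = cnj c * cdot x y"
  and cdot_scale_right: "cdot x (c *s y) = c * cdot x y"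
  and cdot_minus_right: "cdot x (- y) = - cdot x y"
  and cdot_0_left: "cdot 0 y = 0"
  and cdot_0_right: "cdot x 0 = 0"
  by (simp_all add: cdot_def sum.distrib sum_subtractf sum_distrib_left sum_negf algebra_simps)

lemmas cdot_linear = cdot_add_left cdot_add_right cdot_diff_left cdot_diff_right
  cdot_scale_left cdot_scale_right cdot_minus_right cdot_0_left cdot_0_right

lemma cnj_cdot: "cnj (cdot x y) = cdot y x"
  by (simp add: cdot_def mult.commute)

lemma Re_cdot_commute: "Re (cdot x y) = Re (cdot y x)"
  by (metis cnj_cdot cnj.simps(1))

lemma Re_cdot: "Re (cdot x y) = x \<bullet> y"
  by (simp add: cdot_def inner_vec_def inner_complex_def)

lemma cdot_self: "cdot x x = of_real ((norm x)\<^sup>2)"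
proof -
  have "Im (cdot x x) = 0" by (simp add: cdot_def mult.commute)
  then show ?thesis
    by (simp add: complex_eq_iff Re_cdot power2_norm_eq_inner)
qed

lemma norm_scale_vec: "norm (c *s x) = cmod c * norm (x :: complex^'n)"
proof -
  have "of_real ((norm (c *s x))\<^sup>2) = complex_of_real ((cmod c * norm x)\<^sup>2)"
    unfolding cdot_self[symmetric] cdot_scale_left cdot_scale_right
    by (simp add: cdot_self power_mult_distrib flip: complex_norm_square)
  then have "(norm (c *s x))\<^sup>2 = (cmod c * norm x)\<^sup>2" using of_real_eq_iff by blast
  then show ?thesis by simp
qed

lemma adj_adj [simp]: "adj (adj A) = A"
  by (simp add: adj_def vec_eq_iff)

lemma adj_mat_1 [simp]: "adj (mat 1) = mat 1"
  by (auto simp: adj_def mat_def vec_eq_iff)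

lemma adj_add: "adj (A + B) = adj A + adj B"
  and adj_diff: "adj (A - B) = adj A - adj B"
  and adj_mscale: "adj (mscale c A) = mscale (cnj c) (adj A)"
  and adj_outer: "adj (outer x y) = outer y x"
  by (simp_all add: adj_def mscale_def outer_def vec_eq_iff mult.commute)

lemma cdot_mult_right: "cdot x (A *v y) = cdot (adj A *v x) y"
proof -
  have "cdot x (A *v y) = (\<Sum>i\<in>UNIV. \<Sum>j\<in>UNIV. cnj (x $ i) * A $ i $ j * y $ j)"
    by (simp add: cdot_def matrix_vector_mult_def sum_distrib_left mult.assoc)
  also have "\<dots> = (\<Sum>j\<in>UNIV. \<Sum>i\<in>UNIV. cnj (x $ i) * A $ i $ j * y $ j)"
    by (rule sum.swap)
  finally show ?thesis
    by (simp add: cdot_def matrix_vector_mult_def sum_distrib_left sum_distrib_right adj_def mult_ac)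
qed

lemma cdot_mult_left: "cdot (A *v x) y = cdot x (adj A *v y)"
  by (simp add: cdot_mult_right)

lemma outer_mult: "outer x y *v z = cdot y z *s x"
  by (simp add: outer_def cdot_def matrix_vector_mult_def vec_eq_iff sum_distrib_left mult_ac)

lemma mscale_mult: "mscale c A *v x = c *s (A *v x)"
  by (simp add: mscale_def matrix_vector_mult_def vec_eq_iff sum_distrib_left mult_ac)

lemma matrix_scale_mult: "A *v (c *s x) = c *s (A *v x)" for A :: "complex^'n^'m"
  by (simp add: matrix_vector_mult_def vec_eq_iff sum_distrib_left mult_ac)

lemma mscale_mat_1_mult: "mscale c (mat 1) *v x = c *s x"
  by (simp add: mscale_mult)

lemma outer_add_left: "outer (x + y) z = outer x z + outer y z"
  and outer_add_right: "outer x (y + z) = outer x y + outer x z"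
  and outer_scale_left: "outer (c *s x) z = mscale c (outer x z)"
  and outer_scale_right: "outer x (c *s z) = mscale (cnj c) (outer x z)"
  by (simp_all add: outer_def mscale_def vec_eq_iff algebra_simps)

lemma trace_mult: "trace (A ** B) = (\<Sum>i\<in>UNIV. \<Sum>j\<in>UNIV. A $ i $ j * B $ j $ i)"
  for A B :: "complex^'n^'n"
  by (simp add: trace_def matrix_matrix_mult_def)

lemma trace_mult_outer: "trace (A ** outer x y) = cdot y (A *v x)"
  by (simp add: trace_mult cdot_def matrix_vector_mult_def outer_def sum_distrib_left mult_ac)

lemma trace_mult_adj: "trace (adj A ** adj B) = cnj (trace (A ** B))"
  unfolding trace_mult by (subst sum.swap) (simp add: adj_def)

lemma trace_linear:
  fixes A B C :: "complex^'n^'n"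
  shows "trace ((A + B) ** C) = trace (A ** C) + trace (B ** C)"
    and "trace (C ** (A + B)) = trace (C ** A) + trace (C ** B)"
    and "trace ((A - B) ** C) = trace (A ** C) - trace (B ** C)"
    and "trace (C ** (A - B)) = trace (C ** A) - trace (C ** B)"
    and "trace (mscale c A ** C) = c * trace (A ** C)"
    and "trace (C ** mscale c A) = c * trace (C ** A)"
  by (simp_all add: trace_mult mscale_def algebra_simps sum.distrib sum_subtractf sum_distrib_left)

section \<open>Contractions and the vectors on which they are isometric\<close>

definition contraction :: "complex^'n^'n \<Rightarrow> bool"
  where "contraction A \<longleftrightarrow> (\<forall>x. norm (A *v x) \<le> norm x)"

text \<open>Cauchy-Schwarz for \<open>cdot x (A *v (adj A *v x))\<close>, the square of the norm to
  be bounded, lets one factor cancel.\<close>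

lemma contraction_adj:
  assumes "contraction A"
  shows "contraction (adj A)"
  unfolding contraction_def
proof
  fix x
  have "(norm (adj A *v x))\<^sup>2 = Re (cdot x (A *v (adj A *v x)))"
    by (simp add: cdot_mult_right cdot_self)
  also have "\<dots> \<le> norm x * norm (A *v (adj A *v x))"
    by (simp add: Re_cdot norm_cauchy_schwarz)
  also have "\<dots> \<le> norm x * norm (adj A *v x)"
    using assms by (simp add: contraction_def mult_left_mono)
  finally show "norm (adj A *v x) \<le> norm x"
    by (cases "norm (adj A *v x) = 0") (simp_all add: power2_eq_square)
qed

lemma norm_diff_square: "(norm (x - y))\<^sup>2 = (norm x)\<^sup>2 - 2 * Re (cdot x y) + (norm y)\<^sup>2"
  unfolding Re_cdot by (simp add: power2_norm_eq_inner algebra_simps inner_commute)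

lemma norm_add_square: "(norm (x + y))\<^sup>2 = (norm x)\<^sup>2 + 2 * Re (cdot x y) + (norm y)\<^sup>2"
  unfolding Re_cdot by (simp add: power2_norm_eq_inner algebra_simps inner_commute)

text \<open>Equality case of Cauchy-Schwarz for \<open>cdot (adj A *v (A *v x)) x\<close>. The
  vectors whose norm \<open>A\<close> preserves thus satisfy a linear equation and form a
  subspace.\<close>

lemma contraction_isometric_vector:
  assumes "contraction A" "norm (A *v x) = norm x"
  shows "adj A *v (A *v x) = x"
proof -
  have "norm (adj A *v (A *v x)) \<le> norm x"
    using contraction_adj[OF assms(1)] assms(2) by (metis contraction_def)
  then have "(norm (adj A *v (A *v x)))\<^sup>2 \<le> (norm x)\<^sup>2" by (simp add: power_mono)
  moreover have "Re (cdot (adj A *v (A *v x)) x) = (norm x)\<^sup>2"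
    by (simp add: cdot_mult_left cdot_self assms(2))
  ultimately have "(norm (adj A *v (A *v x) - x))\<^sup>2 \<le> 0" by (simp add: norm_diff_square)
  then show ?thesis by simp
qed


subsection \<open>Positive semi-definite matrices\<close>

lemma pos_semidef_iff:
  "pos_semidef A \<longleftrightarrow> adj A = A \<and> (\<forall>x. 0 \<le> Re (cdot x (A *v x)))"
proof -
  have "(\<forall>i j. A $ i $ j = cnj (A $ j $ i)) \<longleftrightarrow> adj A = A"
    unfolding vec_eq_iff adj_def vec_lambda_beta by metis
  moreover have "(\<Sum>i\<in>UNIV. \<Sum>j\<in>UNIV. cnj (x $ i) * A $ i $ j * x $ j) = cdot x (A *v x)" for x
    by (simp add: cdot_def matrix_vector_mult_def sum_distrib_left mult.assoc)
  ultimately show ?thesis by (simp add: pos_semidef_def)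
qed

lemma pos_semidef_outer: "pos_semidef (outer x x)"
proof -
  have "cdot z (outer x x *v z) = of_real ((cmod (cdot x z))\<^sup>2)" for z
    by (simp add: outer_mult cdot_scale_right complex_norm_square cnj_cdot del: of_real_power)
  then show ?thesis by (simp add: pos_semidef_iff adj_outer)
qed

lemma matrix_entry: "A $ i $ j = cdot (axis i 1) (A *v axis j 1)"
  by (simp add: cdot_def matrix_vector_mult_def axis_def if_distrib if_distribR sum.delta cong: if_cong)

lemma hermitian_entry: "adj A = A \<Longrightarrow> cnj (A $ i $ j) = A $ j $ i"
  unfolding vec_eq_iff adj_def vec_lambda_beta by metis

lemma pos_semidef_diag:
  assumes "pos_semidef A"
  shows "A $ i $ i = of_real (Re (A $ i $ i))" "0 \<le> Re (A $ i $ i)"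
proof -
  have "cnj (A $ i $ i) = A $ i $ i" using assms by (simp add: pos_semidef_iff hermitian_entry)
  then show "A $ i $ i = of_real (Re (A $ i $ i))" by (simp add: complex_eq_iff)
  show "0 \<le> Re (A $ i $ i)" using assms unfolding matrix_entry by (simp add: pos_semidef_iff)
qed

lemma pos_semidef_zero_diag:
  assumes "pos_semidef A" "A $ i $ i = 0"
  shows "A $ i $ j = 0"
proof (rule ccontr)
  assume nz: "A $ i $ j \<noteq> 0"
  define a where "a = A $ i $ j"
  \<comment> \<open>Since \<open>A $ i $ i\<close> vanishes, the form at \<open>z\<close> is affine
    in \<open>s\<close>; this value makes it equal to \<open>-1\<close>.\<close>
  define s where "s = (Re (A $ j $ j) + 1) / (2 * (cmod a)\<^sup>2)"
  define z where "z = axis j 1 - (of_real s * a) *s axis i 1"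
  have ji: "A $ j $ i = cnj a"
    using assms(1) by (simp add: a_def pos_semidef_iff hermitian_entry)
  have "cdot z (A *v z) = A $ j $ j - of_real s * a * A $ j $ i - of_real s * cnj a * A $ i $ j
      + of_real (s * s) * a * cnj a * A $ i $ i"
    by (simp add: z_def matrix_vector_mult_diff_distrib matrix_scale_mult cdot_linear
        flip: matrix_entry) (simp add: algebra_simps)
  also have "\<dots> = A $ j $ j - of_real (2 * s * (cmod a)\<^sup>2)"
    using complex_norm_square[of a] by (simp add: ji assms(2) algebra_simps flip: a_def)
  finally have "Re (cdot z (A *v z)) = Re (A $ j $ j) - 2 * s * (cmod a)\<^sup>2" by simp
  also have "\<dots> = - 1" using nz by (simp add: s_def field_simps flip: a_def)
  finally have "Re (cdot z (A *v z)) = - 1" .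
  then show False using assms(1) unfolding pos_semidef_iff by (metis neg_0_le_iff_le not_one_le_zero)
qed

lemma pos_semidef_schur_complement:
  assumes "pos_semidef A" "A $ i $ i \<noteq> 0"
  shows "pos_semidef (A - mscale (1 / A $ i $ i) (outer (A *v axis i 1) (A *v axis i 1)))"
proof -
  define a c where "a = A $ i $ i" and "c = A *v axis i 1"
  have a: "cnj a = a" "a \<noteq> 0" and herm: "adj A = A"
    using assms by (simp_all add: a_def pos_semidef_iff hermitian_entry)
  have ac: "cdot (axis i 1) c = a" by (simp add: a_def c_def matrix_entry)
  have cx: "cdot (axis i 1) (A *v x) = cdot c x" for x
    by (simp add: c_def cdot_mult_right herm)
  have "Re (cdot x ((A - mscale (1 / a) (outer c c)) *v x)) \<ge> 0" for x
  proof -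
    \<comment> \<open>Among the translates of \<open>x\<close> along \<open>axis i 1\<close> this
      one minimises the form of \<open>A\<close>, and the minimum is the form of the Schur
      complement at \<open>x\<close>.\<close>
    define z where "z = x - (cdot c x / a) *s axis i 1"
    have "cdot z (A *v z) = cdot x ((A - mscale (1 / a) (outer c c)) *v x)"
      using a by (simp add: z_def matrix_vector_mult_diff_distrib matrix_scale_mult cdot_linear
          matrix_vector_mult_diff_rdistrib mscale_mult outer_mult cx cnj_cdot flip: c_def)
        (simp add: ac field_simps)
    then show ?thesis using assms(1) unfolding pos_semidef_iff by metis
  qed
  moreover have "adj (A - mscale (1 / a) (outer c c)) = A - mscale (1 / a) (outer c c)"
    using a by (simp add: adj_diff adj_mscale adj_outer herm)
  ultimately show ?thesis by (simp add: pos_semidef_iff a_def c_def)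
qed

text \<open>Schur complements peel off one rank-one summand of the first factor at a time.\<close>

lemma trace_mult_pos_semidef:
  assumes "pos_semidef A" "pos_semidef B"
  shows "0 \<le> Re (trace (A ** B))"
  using assms(1)
proof (induction "card {i. A $ i $ i \<noteq> 0}" arbitrary: A rule: less_induct)
  case less
  show ?case
  proof (cases "\<exists>i. A $ i $ i \<noteq> 0")
    case False
    then have "A = 0" using pos_semidef_zero_diag[OF less.prems] by (simp add: vec_eq_iff)
    then show ?thesis by (simp add: trace_def)
  next
    case True
    then obtain i where i: "A $ i $ i \<noteq> 0" by blast
    define a c where "a = A $ i $ i" and "c = A *v axis i 1"
    define A' where "A' = A - mscale (1 / a) (outer c c)"
    have c: "c $ j = A $ j $ i" for j
      by (simp add: c_def matrix_vector_mult_def axis_def if_distrib if_distribR sum.delta cong: if_cong)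
    have herm: "cnj (A $ j $ i) = A $ i $ j" for j
      using less.prems by (simp add: pos_semidef_iff hermitian_entry)
    have A'_entry: "A' $ j $ j = A $ j $ j - A $ j $ i * A $ i $ j / a" for j
      by (simp add: A'_def mscale_def outer_def c herm)
    have psd: "pos_semidef A'"
      unfolding A'_def a_def c_def by (rule pos_semidef_schur_complement[OF less.prems i])
    \<comment> \<open>The measure drops: a zero on the diagonal persists because its whole row is
      zero, and the \<open>i\<close>-th diagonal entry becomes zero.\<close>
    have "A' $ j $ j = 0" if "A $ j $ j = 0" for j
      using pos_semidef_zero_diag[OF less.prems that] that by (simp add: A'_entry)
    moreover have "A' $ i $ i = 0" using i by (simp add: A'_entry a_def)
    ultimately have "{j. A' $ j $ j \<noteq> 0} \<subset> {j. A $ j $ j \<noteq> 0}" using i by blast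
    then have IH: "0 \<le> Re (trace (A' ** B))"
      by (intro less.hyps psd psubset_card_mono) simp_all
    have "trace (A ** B) = trace (A' ** B) + trace (outer c c ** B) / a"
      by (simp add: A'_def trace_linear)
    also have "trace (outer c c ** B) = cdot c (B *v c)"
      by (simp add: trace_mul_sym[of "outer c c"] trace_mult_outer)
    finally have eq: "trace (A ** B) = trace (A' ** B) + cdot c (B *v c) / a" .
    obtain r where r: "a = of_real r" "0 \<le> r"
      unfolding a_def using pos_semidef_diag[OF less.prems] by blast
    have "0 \<le> Re (cdot c (B *v c)) / r"
      using assms(2) r(2) by (simp add: pos_semidef_iff)
    then have "0 \<le> Re (cdot c (B *v c) / a)" by (simp add: r(1))
    then show ?thesis using IH by (simp add: eq)
  qed
qed


subsection \<open>Two-by-two block matrices\<close>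

definition bvec :: "complex^'n \<Rightarrow> complex^'n \<Rightarrow> complex^(2 \<times> 'n)"
  where "bvec x y = (\<chi> p. (if fst p = 1 then x else y) $ snd p)"

text \<open>The lower left block is tied to \<open>adj B\<close>, so hermiticity only concerns the
  diagonal blocks.\<close>

definition bmat :: "complex^'n^'n \<Rightarrow> complex^'n^'n \<Rightarrow> complex^'n^'n \<Rightarrow> complex^(2 \<times> 'n)^(2 \<times> 'n)"
  where "bmat A B C = (\<chi> p q.
    (if fst p = 1 then if fst q = 1 then A else B else if fst q = 1 then adj B else C) $ snd p $ snd q)"

lemma sum_two_times: "(\<Sum>p\<in>UNIV. f p) = (\<Sum>i\<in>UNIV. f (1, i)) + (\<Sum>i\<in>UNIV. f (2, i))"
  for f :: "2 \<times> 'n::finite \<Rightarrow> 'a::comm_monoid_add"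
proof -
  have "(\<Sum>p\<in>UNIV. f p) = (\<Sum>a\<in>UNIV. \<Sum>i\<in>UNIV. f (a, i))"
    by (simp add: sum.cartesian_product)
  then show ?thesis by (simp add: UNIV_2)
qed

lemma vec_eq_bvec: "z = bvec (\<chi> i. z $ (1, i)) (\<chi> i. z $ (2, i))"
proof -
  have "z $ (a, i) = bvec (\<chi> i. z $ (1, i)) (\<chi> i. z $ (2, i)) $ (a, i)" for a i
    using exhaust_2[of a] by (auto simp: bvec_def)
  then show ?thesis unfolding vec_eq_iff split_paired_All by blast
qed

lemma cdot_bvec: "cdot (bvec x y) (bvec x' y') = cdot x x' + cdot y y'"
  by (simp add: cdot_def sum_two_times bvec_def)

lemma bmat_mult_bvec: "bmat A B C *v bvec x y = bvec (A *v x + B *v y) (adj B *v x + C *v y)"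
  by (simp add: vec_eq_iff matrix_vector_mult_def sum_two_times bvec_def bmat_def)

lemma adj_bmat:
  assumes "adj A = A" "adj C = C"
  shows "adj (bmat A B C) = bmat A B C"
proof -
  have "adj (bmat A B C) $ p $ q = bmat A B C $ p $ q" for p q
    using hermitian_entry[OF assms(1), of "snd q" "snd p"] hermitian_entry[OF assms(2), of "snd q" "snd p"]
    by (simp add: adj_def bmat_def)
  then show ?thesis by (simp add: vec_eq_iff)
qed

lemma pos_semidef_bmat:
  assumes "adj A = A" "adj C = C"
    and "\<And>x y. 0 \<le> Re (cdot x (A *v x)) + Re (cdot y (C *v y)) + 2 * Re (cdot x (B *v y))"
  shows "pos_semidef (bmat A B C)"
proof -
  have "cdot (bvec x y) (bmat A B C *v bvec x y)
      = cdot x (A *v x) + cdot y (C *v y) + (cdot x (B *v y) + cnj (cdot x (B *v y)))" for x y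
    by (simp add: bmat_mult_bvec cdot_bvec cdot_linear cnj_cdot cdot_mult_left[of B y x])
  then have "0 \<le> Re (cdot (bvec x y) (bmat A B C *v bvec x y))" for x y
    using assms(3)[of x y] by simp
  then have "0 \<le> Re (cdot z (bmat A B C *v z))" for z
    using vec_eq_bvec[of z] by metis
  then show ?thesis by (simp add: pos_semidef_iff adj_bmat assms)
qed

lemma id_tensor_outer_bvec_entry:
  "id_tensor \<Phi> (outer (bvec x y) (bvec x y)) $ (a, i) $ (b, j)
    = \<Phi> (outer (if a = 1 then x else y) (if b = 1 then x else y)) $ i $ j"
  unfolding id_tensor_def outer_def bvec_def vec_lambda_beta fst_conv snd_conv ..

lemma bmat_entry:
  "bmat A B C $ (1, i) $ (1, j) = A $ i $ j" "bmat A B C $ (1, i) $ (2, j) = B $ i $ j"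
  "bmat A B C $ (2, i) $ (1, j) = adj B $ i $ j" "bmat A B C $ (2, i) $ (2, j) = C $ i $ j"
  by (simp_all add: bmat_def)

text \<open>The trace transposes block positions: \<open>B\<close>, in the upper right block, meets
  the lower left block \<open>\<Phi> (outer y x)\<close>.\<close>

lemma trace_id_tensor_outer_bmat:
  "trace (id_tensor \<Phi> (outer (bvec x y) (bvec x y)) ** bmat A B C)
    = trace (\<Phi> (outer x x) ** A) + trace (\<Phi> (outer y y) ** C)
      + trace (\<Phi> (outer y x) ** B) + trace (\<Phi> (outer x y) ** adj B)"
proof -
  define M where "M = id_tensor \<Phi> (outer (bvec x y) (bvec x y))"
  have M: "M $ (1, i) $ (1, j) = \<Phi> (outer x x) $ i $ j" "M $ (1, i) $ (2, j) = \<Phi> (outer x y) $ i $ j"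
    "M $ (2, i) $ (1, j) = \<Phi> (outer y x) $ i $ j" "M $ (2, i) $ (2, j) = \<Phi> (outer y y) $ i $ j" for i j
    unfolding M_def id_tensor_outer_bvec_entry by simp_all
  show ?thesis
    unfolding M_def[symmetric] trace_mult sum_two_times M bmat_entry sum.distrib
    by (simp only: ac_simps)

qed


subsection \<open>The infinitesimal form of the hypotheses\<close>

text \<open>Under a functional the exponential becomes a real power series in \<open>t\<close>,
  whose derivative at 0 is the coefficient of order one.\<close>

lemma op_exp_has_derivative_0:
  fixes L :: "'a::banach \<Rightarrow> 'a" and \<phi> :: "'a \<Rightarrow> real"
  assumes L: "bounded_linear L" and \<phi>: "bounded_linear \<phi>"
  shows "((\<lambda>t. \<phi> (op_exp (\<lambda>X. t *\<^sub>R L X) X)) has_real_derivative \<phi> (L X)) (at 0)"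
proof -
  define c where "c n = \<phi> ((L ^^ n) X) / fact n" for n
  have pow: "((\<lambda>X. t *\<^sub>R L X) ^^ n) X = t ^ n *\<^sub>R (L ^^ n) X" for t n
    by (induction n) (simp_all add: linear_simps[OF L])
  have sums: "(\<lambda>n. c n * t ^ n) sums \<phi> (op_exp (\<lambda>X. t *\<^sub>R L X) X)" for t
  proof -
    have "bounded_linear (\<lambda>X. t *\<^sub>R L X)"
      by (intro bounded_linear_compose[OF bounded_linear_scaleR_right] L)
    from bounded_linear.sums[OF \<phi> op_exp_sums[OF this, of X]]
    show ?thesis by (simp add: pow c_def linear_simps[OF \<phi>] divide_inverse mult_ac)
  qed
  \<comment> \<open>Convergence at the point 1 places 0 strictly inside the disc of
    convergence.\<close>
  have "summable (\<lambda>n. c n * 1 ^ n)" using sums sums_summable by blast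
  then have "((\<lambda>t. \<Sum>n. c n * t ^ n) has_real_derivative (\<Sum>n. diffs c n * 0 ^ n)) (at 0)"
    by (rule termdiffs_strong) simp
  moreover have "(\<lambda>t. \<Sum>n. c n * t ^ n) = (\<lambda>t. \<phi> (op_exp (\<lambda>X. t *\<^sub>R L X) X))"
    using sums by (auto simp: sums_iff)
  moreover have "(\<Sum>n. diffs c n * 0 ^ n) = \<phi> (L X)"
    using powser_zero[of "diffs c"] by (simp add: diffs_def c_def)
  ultimately show ?thesis by simp
qed

lemma op_exp_0: "op_exp (\<lambda>X. (0::real) *\<^sub>R L X) X = X"
proof -
  have "((\<lambda>X. (0::real) *\<^sub>R L X) ^^ n) X /\<^sub>R fact n = (if n = 0 then X else 0)" for n
    by (cases n) simp_all
  then show ?thesis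
    unfolding op_exp_def using sums_If_finite[of "\<lambda>n. n = 0" "\<lambda>_. X"] by (simp add: sums_iff)
qed

lemma mscale_of_real: "mscale (of_real r) X = r *\<^sub>R X"
  by (simp add: mscale_def vec_eq_iff) (simp add: scaleR_conv_of_real)

lemma complex_linear_bounded_linear:
  assumes "complex_linear L"
  shows "bounded_linear L"
proof -
  have "linear L"
    using assms unfolding complex_linear_iff
    by (intro linearI) (simp_all flip: mscale_of_real)
  then show ?thesis by (simp add: linear_conv_bounded_linear)
qed

lemma bounded_linear_Re_trace: "bounded_linear (\<lambda>X. Re (trace (X ** B)))"
  for B :: "complex^'n^'n"
proof -
  have "linear (\<lambda>X :: complex^'n^'n. Re (trace (X ** B)))"
    by (intro linearI) (simp_all add: trace_linear flip: mscale_of_real)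
  then show ?thesis by (simp add: linear_conv_bounded_linear)
qed

lemma right_derivative_nonneg:
  fixes f :: "real \<Rightarrow> real"
  assumes "(f has_real_derivative D) (at 0)" "f 0 = 0" "\<And>t. t \<ge> 0 \<Longrightarrow> 0 \<le> f t"
  shows "0 \<le> D"
proof (rule ccontr)
  assume "\<not> 0 \<le> D"
  then obtain d where d: "d > 0" "\<And>h. h > 0 \<Longrightarrow> h < d \<Longrightarrow> f (0 + h) < f 0"
    using DERIV_neg_dec_right[OF assms(1)] by (metis not_le)
  have "f (0 + d / 2) < f 0" by (rule d(2)) (use d(1) in simp_all)
  then show False using d(1) assms(2) assms(3)[of "d / 2"] by simp
qed

section \<open>The generator and its one-sided derivative conditions\<close>

locale two_positive_generator =
  fixes L :: "complex^'n^'n \<Rightarrow> complex^'n^'n"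
  assumes complex_linear: "complex_linear L"
    and two_positive: "\<And>t::real. t \<ge> 0 \<Longrightarrow> two_positive (op_exp (\<lambda>X. t *\<^sub>R L X))"
    and trace_preserving: "\<And>t::real. t \<ge> 0 \<Longrightarrow> trace_preserving (op_exp (\<lambda>X. t *\<^sub>R L X))"
begin

lemma L_add: "L (X + Y) = L X + L Y"
  and L_scale: "L (mscale c X) = mscale c (L X)"
  using complex_linear by (simp_all add: complex_linear_iff)

lemma id_tensor_pos_semidef:
  assumes "t \<ge> 0"
  shows "pos_semidef (id_tensor (op_exp (\<lambda>X. t *\<^sub>R L X)) (outer (bvec x y) (bvec x y)))"
  using two_positive[OF assms] pos_semidef_outer by (auto simp: two_positive_def positive_map_def)

text \<open>The identity is known only for nonnegative times, so the one-sided derivative test is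
  applied to the difference and to its negative. The constant \<open>k\<close> absorbs a conserved
  quantity such as the trace.\<close>

lemma generator_transfer:
  assumes eq: "\<And>t. t \<ge> 0 \<Longrightarrow> \<phi> (op_exp (\<lambda>X. t *\<^sub>R L X) X) = \<psi> (op_exp (\<lambda>X. t *\<^sub>R L X) Y) + k"
    and "bounded_linear \<phi>" "bounded_linear \<psi>"
  shows "\<phi> (L X) = (\<psi> (L Y) :: real)"
proof -
  let ?f = "\<lambda>t. \<phi> (op_exp (\<lambda>X. t *\<^sub>R L X) X) - \<psi> (op_exp (\<lambda>X. t *\<^sub>R L X) Y) - k"
  have d: "(?f has_real_derivative (\<phi> (L X) - \<psi> (L Y) - 0)) (at 0)"
    by (intro DERIV_diff DERIV_const op_exp_has_derivative_0 assms complex_linear_bounded_linear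
        complex_linear)
  then have d': "((\<lambda>t. - ?f t) has_real_derivative - (\<phi> (L X) - \<psi> (L Y) - 0)) (at 0)"
    by (rule DERIV_minus)
  have "0 \<le> \<phi> (L X) - \<psi> (L Y) - 0"
    by (rule right_derivative_nonneg[OF d]) (use eq[of 0] eq in simp_all)
  moreover have "0 \<le> - (\<phi> (L X) - \<psi> (L Y) - 0)"
    by (rule right_derivative_nonneg[OF d']) (use eq[of 0] eq in simp_all)
  ultimately show ?thesis by simp
qed

text \<open>The off-diagonal blocks of the image of the rank-one matrix of \<open>(x, y)\<close> are
  adjoint to each other at every time, and this passes to the derivative.\<close>

lemma hermitian_outer: "L (outer x y) = adj (L (outer y x))"
proof -
  have eq: "op_exp (\<lambda>X. t *\<^sub>R L X) (outer x y) $ i $ j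
      = cnj (op_exp (\<lambda>X. t *\<^sub>R L X) (outer y x) $ j $ i)" if "t \<ge> 0" for t i j
  proof -
    define M where "M = id_tensor (op_exp (\<lambda>X. t *\<^sub>R L X)) (outer (bvec x y) (bvec x y))"
    have "adj M = M"
      using id_tensor_pos_semidef[OF that, of x y] by (simp add: M_def pos_semidef_iff)
    then have "M $ (1, i) $ (2, j) = cnj (M $ (2, j) $ (1, i))"
      by (simp add: hermitian_entry)
    then show ?thesis by (simp add: M_def id_tensor_outer_bvec_entry)
  qed
  have bl: "bounded_linear (\<lambda>X :: complex^'n^'n. Re (X $ i $ j))"
    "bounded_linear (\<lambda>X :: complex^'n^'n. Im (X $ i $ j))"
    "bounded_linear (\<lambda>X :: complex^'n^'n. - Im (X $ i $ j))" for i j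
    by (auto intro!: linearI simp: linear_conv_bounded_linear[symmetric])
  have "Re (L (outer x y) $ i $ j) = Re (L (outer y x) $ j $ i)" for i j
    by (rule generator_transfer[where k = 0]) (simp_all add: eq bl)
  moreover have "Im (L (outer x y) $ i $ j) = - Im (L (outer y x) $ j $ i)" for i j
    by (rule generator_transfer[where k = 0]) (simp_all add: eq bl)
  ultimately show ?thesis by (simp add: vec_eq_iff adj_def complex_eq_iff)
qed

lemma trace_L: "trace (L X) = 0"
proof -
  have bl: "bounded_linear (\<lambda>X :: complex^'n^'n. Re (trace X))"
    "bounded_linear (\<lambda>X :: complex^'n^'n. Im (trace X))"
    by (auto intro!: linearI simp: linear_conv_bounded_linear[symmetric] trace_def sum.distrib sum_distrib_left)
  have tp: "trace (op_exp (\<lambda>X. t *\<^sub>R L X) X) = trace X" if "t \<ge> 0" for t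
    using trace_preserving[OF that] by (simp add: trace_preserving_def)
  have "Re (trace (L X)) = 0"
    by (rule generator_transfer[where \<psi> = "\<lambda>_. 0" and k = "Re (trace X)"]) (simp_all add: tp bl)
  moreover have "Im (trace (L X)) = 0"
    by (rule generator_transfer[where \<psi> = "\<lambda>_. 0" and k = "Im (trace X)"]) (simp_all add: tp bl)
  ultimately show ?thesis by (simp add: complex_eq_iff)
qed

abbreviation \<beta> :: "complex^'n^'n \<Rightarrow> complex^'n^'n \<Rightarrow> complex"
  where "\<beta> A B \<equiv> trace (L A ** B)"

lemma beta_hermitian: "\<beta> (outer x y) (adj B) = cnj (\<beta> (outer y x) B)"
  using trace_mult_adj[of "L (outer y x)" B] by (simp add: hermitian_outer[symmetric])

text \<open>The evolved rank-one matrix of \<open>(x, y)\<close> is paired with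
  \<open>bmat A B C\<close>. At time 0 this gives the form at \<open>(x, y)\<close>, which is 0;
  later it is nonnegative as the trace of a product of two positive semi-definite matrices. So the
  derivative at 0 is nonnegative.\<close>

lemma conditional_two_positivity:
  assumes "adj A = A" "adj C = C"
    and nonneg: "\<And>x y. 0 \<le> Re (cdot x (A *v x)) + Re (cdot y (C *v y)) + 2 * Re (cdot x (B *v y))"
    and zero: "Re (cdot x (A *v x)) + Re (cdot y (C *v y)) + 2 * Re (cdot x (B *v y)) = 0"
  shows "0 \<le> Re (\<beta> (outer x x) A) + Re (\<beta> (outer y y) C) + 2 * Re (\<beta> (outer y x) B)"
proof -
  let ?E = "\<lambda>t. op_exp (\<lambda>X. t *\<^sub>R L X)"
  define f where "f t = Re (trace (?E t (outer x x) ** A)) + Re (trace (?E t (outer y y) ** C))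
      + Re (trace (?E t (outer y x) ** B)) + Re (trace (?E t (outer x y) ** adj B))" for t
  have "(f has_real_derivative (Re (\<beta> (outer x x) A) + Re (\<beta> (outer y y) C)
      + Re (\<beta> (outer y x) B) + Re (\<beta> (outer x y) (adj B)))) (at 0)"
    unfolding f_def
    by (intro DERIV_add op_exp_has_derivative_0[where \<phi> = "\<lambda>X. Re (trace (X ** _))"]
        bounded_linear_Re_trace complex_linear_bounded_linear complex_linear)
  moreover have "f 0 = 0"
    using zero unfolding f_def op_exp_0
    by (simp add: trace_mul_sym[of "outer _ _"] trace_mult_outer
        cdot_mult_left[symmetric] Re_cdot_commute[of "B *v y" x])
  moreover have "0 \<le> f t" if "t \<ge> 0" for t
    using trace_mult_pos_semidef[OF id_tensor_pos_semidef[OF that] pos_semidef_bmat[OF assms(1-3)]]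
    by (simp add: f_def trace_id_tensor_outer_bmat)
  ultimately have "0 \<le> Re (\<beta> (outer x x) A) + Re (\<beta> (outer y y) C)
      + Re (\<beta> (outer y x) B) + Re (\<beta> (outer x y) (adj B))"
    by (rule right_derivative_nonneg)
  then show ?thesis by (simp add: beta_hermitian)
qed

end


subsection \<open>The distance to the scalars\<close>

lemma bounded_linear_matrix_vector: "bounded_linear ((*v) A)" for A :: "complex^'n^'n"
proof -
  have "r *\<^sub>R x = complex_of_real r *s x" for r and x :: "complex^'n"
    by (simp add: vec_eq_iff) (simp add: scaleR_conv_of_real)
  then have "A *v (r *\<^sub>R x) = r *\<^sub>R (A *v x)" for r x
    by (simp add: matrix_scale_mult)
  then have "linear ((*v) A)" by (intro linearI) (simp_all add: matrix_vector_right_distrib)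
  then show ?thesis by (simp add: linear_conv_bounded_linear)
qed

lemma continuous_on_matrix_vector [continuous_intros]:
  "continuous_on S f \<Longrightarrow> continuous_on S (\<lambda>x. A *v (f x))" for A :: "complex^'n^'n"
  using bounded_linear.continuous_on[OF bounded_linear_matrix_vector] .

lemma continuous_on_cdot [continuous_intros]:
  "continuous_on S f \<Longrightarrow> continuous_on S g \<Longrightarrow> continuous_on S (\<lambda>x. cdot (f x) (g x))"
  unfolding cdot_def by (intro continuous_intros)

lemma norm_minus_scalar_square:
  "(norm ((T - mscale c (mat 1)) *v v))\<^sup>2
    = (norm (T *v v))\<^sup>2 - 2 * Re (cnj c * cdot v (T *v v)) + (cmod c)\<^sup>2 * (norm v)\<^sup>2"
proof -
  have "(T - mscale c (mat 1)) *v v = T *v v - c *s v"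
    by (simp add: matrix_vector_mult_diff_rdistrib mscale_mat_1_mult)
  moreover have "Re (cdot (T *v v) (c *s v)) = Re (cnj c * cdot v (T *v v))"
    by (subst Re_cdot_commute) (simp add: cdot_linear)
  ultimately show ?thesis
    by (simp add: norm_diff_square norm_scale_vec power_mult_distrib)
qed

text \<open>The operator norm of \<open>X - mscale c (mat 1)\<close> is continuous and coercive in
  \<open>c\<close>, so a nearest scalar exists. Division by the distance \<open>s\<close> gives a
  contraction whose norm no further scalar shift brings below 1.\<close>

lemma exists_nearest_scalar:
  fixes X :: "complex^'n^'n"
  assumes nonscalar: "\<And>c. X \<noteq> mscale c (mat 1)"
  obtains c s where "s > 0" "contraction (mscale (of_real (1 / s)) (X - mscale c (mat 1)))"
    "\<And>z. \<exists>v. norm v = 1 \<and> 1 \<le> norm ((mscale (of_real (1 / s)) (X - mscale c (mat 1)) - mscale z (mat 1)) *v v)"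
proof -
  define D where "D c = X - mscale c (mat 1)" for c
  define \<nu> where "\<nu> c = onorm ((*v) (D c))" for c
  have D_mult: "D c *v x = X *v x - c *s x" for c x
    by (simp add: D_def matrix_vector_mult_diff_rdistrib mscale_mat_1_mult)
  have bound: "norm (D c *v x) \<le> \<nu> c * norm x" for c x
    unfolding \<nu>_def by (rule onorm[OF bounded_linear_matrix_vector])
  have attained: "\<exists>v. norm v = 1 \<and> norm (D c *v v) = \<nu> c" for c
  proof -
    have "axis undefined 1 \<in> sphere (0 :: complex^'n) 1" by simp
    then have "\<exists>v\<in>sphere 0 1. \<forall>x\<in>sphere 0 1. norm (D c *v x) \<le> norm (D c *v v)"
      by (intro continuous_attains_sup continuous_intros) (auto simp del: mem_sphere)
    then obtain v where v: "norm v = 1" "\<And>x. norm x = 1 \<Longrightarrow> norm (D c *v x) \<le> norm (D c *v v)"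
      by auto
    have "norm (D c *v x) \<le> norm (D c *v v) * norm x" for x
    proof (cases "x = 0")
      case False
      have "norm (D c *v (of_real (1 / norm x) *s x)) \<le> norm (D c *v v)"
        using False by (intro v(2)) (simp add: norm_scale_vec norm_divide)
      then show ?thesis
        using False by (simp add: matrix_scale_mult norm_scale_vec norm_divide field_simps)
    qed simp
    then have "\<nu> c \<le> norm (D c *v v)" unfolding \<nu>_def by (intro onorm_bound) simp_all
    then show ?thesis using bound[of c v] v(1) by (intro exI[of _ v]) simp
  qed
  have lip: "\<nu> c \<le> \<nu> c' + cmod (c - c')" for c c'
  proof -
    obtain v where v: "norm v = 1" "norm (D c *v v) = \<nu> c" using attained by blast
    have "D c *v v = D c' *v v - (c - c') *s v" by (simp add: D_mult vec_eq_iff algebra_simps)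
    then have "norm (D c *v v) \<le> norm (D c' *v v) + norm ((c - c') *s v)"
      by (metis norm_triangle_ineq4)
    then show ?thesis using bound[of c' v] v unfolding norm_scale_vec by simp
  qed
  have coercive: "cmod c \<le> \<nu> c + \<nu> 0" for c
  proof -
    let ?v = "axis undefined 1 :: complex^'n"
    have "c *s ?v = D 0 *v ?v - D c *v ?v" by (simp add: D_mult vec_eq_iff)
    then have "norm (c *s ?v) \<le> norm (D 0 *v ?v) + norm (D c *v ?v)"
      by (simp add: norm_triangle_ineq4)
    then show ?thesis using bound[of 0 ?v] bound[of c ?v] by (simp add: norm_scale_vec)
  qed
  \<comment> \<open>By coercivity \<open>\<nu>\<close> exceeds \<open>\<nu> 0\<close> outside this
    ball, so the minimum over the ball is global.\<close>
  have "continuous_on (cball 0 (2 * \<nu> 0)) \<nu>"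
    unfolding continuous_on_iff dist_norm
  proof (intro ballI allI impI)
    fix c and e :: real assume "e > 0"
    have "norm (\<nu> c' - \<nu> c) < e" if "norm (c' - c) < e" for c'
      using lip[of c' c] lip[of c c'] that by (simp add: norm_minus_commute abs_if)
    then show "\<exists>d>0. \<forall>c'\<in>cball 0 (2 * \<nu> 0). norm (c' - c) < d \<longrightarrow> norm (\<nu> c' - \<nu> c) < e"
      using \<open>e > 0\<close> by blast
  qed
  moreover have "\<nu> 0 \<ge> 0" using coercive[of 0] by simp
  ultimately obtain c where c: "c \<in> cball 0 (2 * \<nu> 0)" "\<And>z. z \<in> cball 0 (2 * \<nu> 0) \<Longrightarrow> \<nu> c \<le> \<nu> z"
    using continuous_attains_inf[of "cball 0 (2 * \<nu> 0)" \<nu>] by auto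
  have min: "\<nu> c \<le> \<nu> z" for z
  proof (cases "z \<in> cball 0 (2 * \<nu> 0)")
    case False
    then show ?thesis using coercive[of z] c(2)[of 0] \<open>\<nu> 0 \<ge> 0\<close> by simp
  qed (rule c(2))
  have pos: "\<nu> c > 0"
  proof (rule ccontr)
    assume "\<not> \<nu> c > 0"
    then have "D c *v x = 0" for x
      using bound[of c x] by (metis mult_nonpos_nonneg norm_ge_zero norm_le_zero_iff not_less order_trans)
    then have "D c = 0" by (simp add: matrix_eq)
    then show False using nonscalar[of c] by (simp add: D_def)
  qed
  let ?T = "mscale (of_real (1 / \<nu> c)) (D c)"
  have "contraction ?T"
    using bound[of c] pos by (simp add: contraction_def mscale_mult norm_scale_vec norm_divide field_simps)
  moreover have "\<exists>v. norm v = 1 \<and> 1 \<le> norm ((?T - mscale z (mat 1)) *v v)" for z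
  proof -
    \<comment> \<open>Shifting \<open>?T\<close> by \<open>z\<close> amounts to shifting
      \<open>X\<close> by this scalar before the division by \<open>\<nu> c\<close>.\<close>
    obtain v where v: "norm v = 1" "norm (D (c + of_real (\<nu> c) * z) *v v) = \<nu> (c + of_real (\<nu> c) * z)"
      using attained by blast
    have "D (c + of_real (\<nu> c) * z) *v v = of_real (\<nu> c) *s ((?T - mscale z (mat 1)) *v v)"
      using pos by (simp add: D_mult matrix_vector_mult_diff_rdistrib mscale_mat_1_mult mscale_mult
          vec_eq_iff field_simps)
    then have "\<nu> c * norm ((?T - mscale z (mat 1)) *v v) \<ge> \<nu> c"
      using v(2) min[of "c + of_real (\<nu> c) * z"] pos by (simp add: norm_scale_vec)
    then show ?thesis using v(1) pos by auto
  qed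
  ultimately show thesis using that[of "\<nu> c" c] pos unfolding D_def by blast
qed

section \<open>Stampfli's theorem on the maximal numerical range\<close>

text \<open>Unit vectors \<open>v n\<close> witness that shifting by the small scalar
  \<open>e n * z\<close> does not lower the norm below 1. Expanding the square bounds the real part
  by a multiple of \<open>e n\<close>, and a limit point of the \<open>v n\<close> is the vector
  sought.\<close>

lemma exists_maximal_vector_halfplane:
  fixes T :: "complex^'n^'n"
  assumes T: "contraction T"
    and min: "\<And>z. \<exists>v. norm v = 1 \<and> 1 \<le> norm ((T - mscale z (mat 1)) *v v)"
  shows "\<exists>v. norm v = 1 \<and> norm (T *v v) = 1 \<and> Re (cnj z * cdot v (T *v v)) \<le> 0"
proof -
  define e where "e n = 1 / real (Suc n)" for n
  define g where "g v = Re (cnj z * cdot v (T *v v))" for v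
  have "\<exists>v. norm v = 1 \<and> 1 \<le> norm ((T - mscale (of_real (e n) * z) (mat 1)) *v v)" for n
    using min by blast
  then obtain v where v: "\<And>n. norm (v n) = 1"
    "\<And>n. 1 \<le> norm ((T - mscale (of_real (e n) * z) (mat 1)) *v v n)" by metis
  have "v n \<in> sphere 0 1" for n using v(1) by simp
  then obtain w r where w: "w \<in> sphere 0 1" "strict_mono r" "(v \<circ> r) \<longlonglongrightarrow> w"
    using compact_sphere[of "0 :: complex^'n" 1] unfolding compact_def by metis
  have e: "(e \<circ> r) \<longlonglongrightarrow> 0"
    unfolding e_def
    by (rule LIMSEQ_subseq_LIMSEQ[OF _ w(2)]) (rule LIMSEQ_Suc[OF lim_const_over_n])
  have key: "1 + 2 * e n * g (v n) - (e n * cmod z)\<^sup>2 \<le> (norm (T *v v n))\<^sup>2" for n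
  proof -
    have "1 \<le> (norm ((T - mscale (of_real (e n) * z) (mat 1)) *v v n))\<^sup>2"
      using v(2)[of n] by (simp add: one_le_power)
    then show ?thesis
      unfolding norm_minus_scalar_square g_def v(1) by (simp add: norm_mult mult.assoc algebra_simps)
  qed
  have cont: "continuous_on UNIV g" "continuous_on UNIV (\<lambda>x. (norm (T *v x))\<^sup>2)"
    unfolding g_def by (intro continuous_intros)+
  have lim: "(\<lambda>n. g (v (r n))) \<longlonglongrightarrow> g w" "(\<lambda>n. (norm (T *v v (r n)))\<^sup>2) \<longlonglongrightarrow> (norm (T *v w))\<^sup>2"
    using continuous_on_tendsto_compose[OF cont(1) w(3)] continuous_on_tendsto_compose[OF cont(2) w(3)]
    by (simp_all add: o_def)
  have elim: "(\<lambda>n. e (r n)) \<longlonglongrightarrow> 0" using e by (simp add: o_def)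
  have "(\<lambda>n. 1 + 2 * e (r n) * g (v (r n)) - (e (r n) * cmod z)\<^sup>2) \<longlonglongrightarrow> 1 + 2 * 0 * g w - (0 * cmod z)\<^sup>2"
    by (intro tendsto_intros lim elim)
  from LIMSEQ_le[OF this lim(2)] key have "1 \<le> (norm (T *v w))\<^sup>2" by auto
  moreover have "norm (T *v w) \<le> 1" using T w(1) by (metis contraction_def mem_sphere_0)
  ultimately have "norm (T *v w) = 1"
    by (metis norm_ge_zero one_power2 order_antisym power2_le_imp_le)
  moreover have "g w \<le> 0"
  proof -
    have "g (v n) \<le> e n * (cmod z)\<^sup>2 / 2" for n
    proof -
      have "(norm (T *v v n))\<^sup>2 \<le> 1"
        using T v(1)[of n] by (metis contraction_def norm_ge_zero power_le_one)
      then have "e n * (2 * g (v n)) \<le> e n * (e n * (cmod z)\<^sup>2)"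
        using key[of n] by (simp add: power_mult_distrib power2_eq_square algebra_simps)
      moreover have "e n > 0" by (simp add: e_def)
      ultimately show ?thesis by simp
    qed
    moreover have "(\<lambda>n. e (r n) * (cmod z)\<^sup>2 / 2) \<longlonglongrightarrow> 0 * (cmod z)\<^sup>2 / 2"
      by (intro tendsto_intros elim) simp
    ultimately show ?thesis using LIMSEQ_le[OF lim(1), of "\<lambda>n. e (r n) * (cmod z)\<^sup>2 / 2" 0] by simp
  qed
  ultimately show ?thesis using w(1) by (auto simp: g_def)
qed

text \<open>The Toeplitz--Hausdorff argument, carried out inside the subspace on which \<open>T\<close> is isometric.\<close>

lemma maximal_numerical_range_convex:
  fixes T :: "complex^'n^'n"
  assumes T: "contraction T"
    and v0: "norm v0 = 1" "norm (T *v v0) = 1" and v1: "norm v1 = 1" "norm (T *v v1) = 1"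
    and \<sigma>: "0 \<le> \<sigma>" "\<sigma> \<le> (1::real)"
  shows "\<exists>v. norm v = 1 \<and> norm (T *v v) = 1 \<and>
    cdot v (T *v v) = cdot v0 (T *v v0) + of_real \<sigma> * (cdot v1 (T *v v1) - cdot v0 (T *v v0))"
proof (cases "cdot v0 (T *v v0) = cdot v1 (T *v v1)")
  case True
  then show ?thesis using v0 by auto
next
  case False
  define a b where "a = cdot v0 (T *v v0)" and "b = cdot v1 (T *v v1)"
  have ab: "a - b \<noteq> 0" using False by (simp add: a_def b_def)
  \<comment> \<open>After the affine normalisation sending \<open>a\<close> to 1 and
    \<open>b\<close> to 0, \<open>p\<close> and \<open>q\<close> are the off-diagonal values of the
    form of \<open>T\<close> on \<open>v0\<close> and \<open>v1\<close>.\<close>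
  define p where "p = (cdot v0 (T *v v1) - b * cdot v0 v1) / (a - b)"
  define q where "q = (cdot v1 (T *v v0) - b * cdot v1 v0) / (a - b)"
  define g where "g = p - cnj q"
  \<comment> \<open>The phase makes \<open>e * p + cnj e * q\<close> real, which keeps the numerical
    values along the path \<open>w\<close> on the line through \<open>a\<close> and
    \<open>b\<close>.\<close>
  obtain e where e: "cmod e = 1" "Im (e * g) = 0"
  proof (cases "g = 0")
    case True
    then show thesis using that[of 1] by simp
  next
    case False
    have "Im (cnj g / of_real (cmod g) * g) = 0"
      by (simp add: complex_norm_square[symmetric] mult.commute flip: of_real_power)
    then show thesis using that[of "cnj g / of_real (cmod g)"] False by (simp add: norm_divide)
  qed
  define \<kappa> where "\<kappa> = Re (e * p + cnj e * q)"
  have \<kappa>: "e * p + cnj e * q = of_real \<kappa>"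
    using e(2) by (simp add: \<kappa>_def complex_eq_iff g_def algebra_simps)
  have ee: "cnj e * e = 1" using e(1) complex_norm_square[of e] by (simp add: mult.commute)
  define w where "w t = of_real (1 - t) *s v0 + (of_real t * e) *s v1" for t
  have cd: "cdot v0 v0 = 1" "cdot v1 v1 = 1" using v0 v1 by (simp_all add: cdot_self)
  have m: "cdot (w t) (T *v w t) - b * cdot (w t) (w t)
      = (a - b) * of_real ((1 - t)\<^sup>2 + t * (1 - t) * \<kappa>)" for t
  proof -
    define \<alpha> where "\<alpha> = complex_of_real (1 - t)"
    have \<alpha>: "cnj \<alpha> = \<alpha>" "w t = \<alpha> *s v0 + (of_real t * e) *s v1" by (simp_all add: \<alpha>_def w_def)
    have "cdot (w t) (T *v w t) - b * cdot (w t) (w t)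
        = \<alpha>\<^sup>2 * (a - b)
          + of_real t * \<alpha> * (e * (cdot v0 (T *v v1) - b * cdot v0 v1)
            + cnj e * (cdot v1 (T *v v0) - b * cdot v1 v0))"
      unfolding \<alpha>(2) a_def b_def
      by (simp add: cdot_linear matrix_vector_right_distrib matrix_scale_mult cd \<alpha>(1))
        (simp add: algebra_simps power2_eq_square)
    also have "\<dots> = of_real ((1 - t)\<^sup>2) * (a - b)
          + of_real (t * (1 - t)) * (e * (cdot v0 (T *v v1) - b * cdot v0 v1)
            + cnj e * (cdot v1 (T *v v0) - b * cdot v1 v0))"
      by (simp add: \<alpha>_def)
    also have "\<dots> = (a - b) * (of_real ((1 - t)\<^sup>2) + of_real (t * (1 - t)) * (e * p + cnj e * q))"
    proof -
      have "cdot v0 (T *v v1) - b * cdot v0 v1 = (a - b) * p" "cdot v1 (T *v v0) - b * cdot v1 v0 = (a - b) * q"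
        using ab by (simp_all add: p_def q_def)
      then show ?thesis by (simp only:) (simp only: algebra_simps)
    qed
    finally show ?thesis by (simp add: \<kappa>)
  qed
  have iso: "adj T *v (T *v w t) = w t" for t
  proof -
    have "adj T *v (T *v v0) = v0" "adj T *v (T *v v1) = v1"
      using contraction_isometric_vector[OF T] v0 v1 by simp_all
    then show ?thesis by (simp only: w_def matrix_vector_right_distrib matrix_scale_mult)
  qed
  \<comment> \<open>A zero of the path would make \<open>v0\<close> and \<open>v1\<close> agree up
    to a phase, hence \<open>a = b\<close>.\<close>
  have wt0: "w t \<noteq> 0" for t
  proof
    assume "w t = 0"
    then have eq: "of_real (1 - t) *s v0 = (- of_real t * e) *s v1"
      unfolding w_def by (simp add: eq_neg_iff_add_eq_0 vec_eq_iff)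
    then have "norm (of_real (1 - t) *s v0) = norm ((- of_real t * e) *s v1)" by simp
    then have "\<bar>1 - t\<bar> = \<bar>t\<bar>" unfolding norm_scale_vec v0 v1 norm_of_real norm_mult norm_minus_cancel e(1)
      by simp
    then have t: "t = 1 / 2" by (simp add: abs_if split: if_splits)
    have "v0 = (- e) *s v1" using eq unfolding t by (simp add: vec_eq_iff)
    then have "a = (cnj e * e) * b"
      unfolding a_def b_def by (simp only: matrix_scale_mult cdot_linear) simp
    then show False using ab ee by simp
  qed
  \<comment> \<open>At a zero of \<open>h\<close> the normalised vector has the value
    \<open>a + of_real \<sigma> * (b - a)\<close>. The endpoint values are
    \<open>h 0 = \<sigma>\<close> and \<open>h 1 = \<sigma> - 1\<close>.\<close>
  define h where "h t = (1 - t)\<^sup>2 + t * (1 - t) * \<kappa> - (1 - \<sigma>) * (norm (w t))\<^sup>2" for t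
  have "continuous_on {0..1} h"
  proof -
    have "continuous_on {0..1} (\<lambda>t. (norm (w t))\<^sup>2)"
    proof -
      have "(norm (w t))\<^sup>2 = Re (cdot (w t) (w t))" for t by (simp add: cdot_self)
      moreover have "continuous_on {0..1} (\<lambda>t. Re (cdot (w t) (w t)))"
        unfolding w_def cdot_linear by (intro continuous_intros)
      ultimately show ?thesis by simp
    qed
    then have "continuous_on {0..1} (\<lambda>t. (1 - \<sigma>) * (norm (w t))\<^sup>2)"
      by (rule continuous_on_mult_left)
    then show ?thesis unfolding h_def by (rule continuous_on_diff[rotated]) (intro continuous_intros)
  qed
  moreover have "h 1 \<le> 0" "0 \<le> h 0"
    using \<sigma> v0 v1 e(1) by (simp_all add: h_def w_def norm_scale_vec)
  ultimately obtain t where t: "0 \<le> t" "t \<le> 1" "h t = 0"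
    using IVT2'[of h 1 0 0] by auto
  define v where "v = of_real (1 / norm (w t)) *s w t"
  have norm_v: "norm v = 1" using wt0[of t] by (simp add: v_def norm_scale_vec norm_divide)
  have "adj T *v (T *v v) = v" by (simp add: v_def matrix_scale_mult iso)
  then have "cdot (T *v v) (T *v v) = cdot v v" by (simp add: cdot_mult_left)
  then have "norm (T *v v) = 1"
    unfolding cdot_self of_real_eq_iff norm_v by (metis norm_ge_zero power2_eq_iff_nonneg zero_le_one)
  moreover have "cdot v (T *v v) = a + of_real \<sigma> * (b - a)"
  proof -
    let ?N = "complex_of_real ((norm (w t))\<^sup>2)"
    have N: "?N \<noteq> 0" using wt0[of t] by simp
    have "cdot (w t) (T *v w t) = b * ?N + (a - b) * of_real ((1 - t)\<^sup>2 + t * (1 - t) * \<kappa>)"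
      using m[of t] by (simp add: cdot_self algebra_simps)
    also have "(1 - t)\<^sup>2 + t * (1 - t) * \<kappa> = (1 - \<sigma>) * (norm (w t))\<^sup>2" using t(3) by (simp add: h_def)
    finally have "cdot (w t) (T *v w t) = (a + of_real \<sigma> * (b - a)) * ?N" by (simp add: algebra_simps)
    moreover have "cdot v (T *v v) = cdot (w t) (T *v w t) / ?N"
      by (simp add: v_def matrix_scale_mult cdot_linear power2_eq_square)
    ultimately show ?thesis using N by simp
  qed
  ultimately show ?thesis using norm_v unfolding a_def b_def by blast
qed

text \<open>Stampfli: at the nearest scalar, \<open>0\<close> lies in the maximal numerical range.\<close>

lemma exists_maximal_vector_orthogonal:
  fixes T :: "complex^'n^'n"
  assumes T: "contraction T"
    and min: "\<And>z. \<exists>v. norm v = 1 \<and> 1 \<le> norm ((T - mscale z (mat 1)) *v v)"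
  shows "\<exists>v. norm v = 1 \<and> norm (T *v v) = 1 \<and> cdot v (T *v v) = 0"
proof -
  define S where "S = {v. norm v = 1 \<and> norm (T *v v) = 1}"
  note half = exists_maximal_vector_halfplane[OF T min]
  have "S = sphere 0 1 \<inter> {v. norm (T *v v) = 1}" by (auto simp: S_def)
  moreover have "closed {v. norm (T *v v) = 1}"
    by (intro closed_Collect_eq continuous_intros)
  ultimately have "compact S" by (simp add: compact_Int_closed)
  moreover have "S \<noteq> {}" using half[of 0] by (auto simp: S_def)
  moreover have "continuous_on S (\<lambda>v. cmod (cdot v (T *v v)))" by (intro continuous_intros)
  ultimately obtain v0 where v0: "v0 \<in> S" "\<And>v. v \<in> S \<Longrightarrow> cmod (cdot v0 (T *v v0)) \<le> cmod (cdot v (T *v v))"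
    using continuous_attains_inf[of S "\<lambda>v. cmod (cdot v (T *v v))"] by blast
  define a where "a = cdot v0 (T *v v0)"
  have "a = 0"
  proof (rule ccontr)
    assume a: "a \<noteq> 0"
    obtain v1 where v1: "v1 \<in> S" "Re (cnj a * cdot v1 (T *v v1)) \<le> 0"
      using half[of a] by (auto simp: S_def)
    define b where "b = cdot v1 (T *v v1)"
    \<comment> \<open>With this choice the squared modulus at
      \<open>a + of_real \<sigma> * (b - a)\<close> is at most
      \<open>(1 - \<sigma>) * (cmod a)\<^sup>2\<close>, against the minimality of
      \<open>v0\<close>.\<close>
    define \<sigma> where "\<sigma> = (cmod a)\<^sup>2 / (cmod (b - a))\<^sup>2"
    have sq: "(cmod (x + y))\<^sup>2 = (cmod x)\<^sup>2 + 2 * Re (cnj x * y) + (cmod y)\<^sup>2" for x y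
      unfolding cmod_power2 by (simp add: power2_eq_square algebra_simps)
    have le: "Re (cnj a * (b - a)) \<le> - (cmod a)\<^sup>2"
      using v1(2) unfolding cmod_power2 b_def[symmetric] by (simp add: power2_eq_square algebra_simps)
    have "(cmod (b - a))\<^sup>2 = (cmod b)\<^sup>2 - 2 * Re (cnj a * b) + (cmod a)\<^sup>2"
      unfolding cmod_power2 by (simp add: power2_eq_square algebra_simps)
    then have "(cmod a)\<^sup>2 \<le> (cmod (b - a))\<^sup>2"
      using v1(2) zero_le_power2[of "cmod b"] unfolding b_def[symmetric] by linarith
    moreover from this have pos: "(cmod (b - a))\<^sup>2 > 0" using a
      by (metis less_le_trans zero_less_norm_iff zero_less_power)
    ultimately have \<sigma>: "0 < \<sigma>" "\<sigma> \<le> 1" using a by (simp_all add: \<sigma>_def)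
    obtain v where v: "v \<in> S" "cdot v (T *v v) = a + of_real \<sigma> * (b - a)"
      using maximal_numerical_range_convex[OF T, of v0 v1 \<sigma>] v0(1) v1(1) \<sigma>
      unfolding S_def a_def b_def by auto
    have "(cmod (a + of_real \<sigma> * (b - a)))\<^sup>2
        = (cmod a)\<^sup>2 + 2 * (\<sigma> * Re (cnj a * (b - a))) + \<sigma> * (\<sigma> * (cmod (b - a))\<^sup>2)"
      unfolding sq norm_mult norm_of_real power_mult_distrib power2_abs
      by (simp add: power2_eq_square algebra_simps)
    also have "\<sigma> * (cmod (b - a))\<^sup>2 = (cmod a)\<^sup>2" using pos by (simp add: \<sigma>_def)
    also have "(cmod a)\<^sup>2 + 2 * (\<sigma> * Re (cnj a * (b - a))) + \<sigma> * (cmod a)\<^sup>2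
        \<le> (cmod a)\<^sup>2 + 2 * (\<sigma> * - (cmod a)\<^sup>2) + \<sigma> * (cmod a)\<^sup>2"
      using le \<sigma> by (intro add_right_mono add_left_mono mult_left_mono) simp_all
    also have "\<dots> < (cmod a)\<^sup>2" using a \<sigma> by simp
    finally have "cmod (cdot v (T *v v)) < cmod a"
      unfolding v(2) by (rule power_less_imp_less_base) simp
    then show False using v0(2)[OF v(1)] by (simp add: a_def)
  qed
  then show ?thesis using v0(1) by (auto simp: S_def a_def)
qed


subsection \<open>A Fejer kernel argument for contractions\<close>

text \<open>Iterates \<open>**\<close>, because \<open>*\<close> on this type multiplies
  entrywise.\<close>

definition mpow :: "complex^'n^'n \<Rightarrow> nat \<Rightarrow> complex^'n^'n"
  where "mpow X n = (((**) X) ^^ n) (mat 1)"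

lemma mpow_0: "mpow X 0 = mat 1"
  and mpow_Suc: "mpow X (Suc n) = X ** mpow X n"
  by (simp_all add: mpow_def)

lemma mpow_1: "mpow X (Suc 0) = X"
  by (simp add: mpow_Suc mpow_0)

lemma mpow_Suc_mult: "mpow X (Suc n) *v x = X *v (mpow X n *v x)"
  by (simp add: mpow_Suc matrix_vector_mul_assoc)

lemma mpow_mscale: "mpow (mscale c X) n = mscale (c ^ n) (mpow X n)"
proof (induction n)
  case 0
  then show ?case by (simp add: mpow_0 mscale_def vec_eq_iff)
next
  case (Suc n)
  have "mscale a A ** mscale b B = mscale (a * b) (A ** B)" for a b and A B :: "complex^'n^'n"
    by (simp add: mscale_def matrix_matrix_mult_def vec_eq_iff sum_distrib_left mult_ac)
  then show ?case using Suc by (simp add: mpow_Suc)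
qed

lemma matrix_vector_mult_sum_right: "A *v (\<Sum>i\<in>I. f i) = (\<Sum>i\<in>I. A *v f i)"
  for A :: "complex^'n^'n"
  by (induction I rule: infinite_finite_induct) (simp_all add: matrix_vector_right_distrib)

lemma matrix_vector_mult_sum_left: "(\<Sum>i\<in>I. f i) *v x = (\<Sum>i\<in>I. f i *v x)"
  for f :: "_ \<Rightarrow> complex^'n^'n"
  by (induction I rule: infinite_finite_induct) (simp_all add: matrix_vector_mult_add_rdistrib)

lemma cdot_sum_right: "cdot x (\<Sum>i\<in>I. f i) = (\<Sum>i\<in>I. cdot x (f i))"
  by (induction I rule: infinite_finite_induct) (simp_all add: cdot_linear)

lemma adj_sum: "adj (\<Sum>i\<in>I. f i) = (\<Sum>i\<in>I. adj (f i))"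
  by (induction I rule: infinite_finite_induct) (simp_all add: adj_add, simp_all add: adj_def vec_eq_iff)

text \<open>The partial sums obey \<open>g (Suc m) = h + Y *v g m\<close>. As \<open>Y\<close> is a
  contraction, expanding squared norms and telescoping bounds \<open>(norm (g N))\<^sup>2\<close> by
  the right-hand side.\<close>

lemma fejer_form_nonneg:
  assumes "contraction Y"
  shows "0 \<le> real N * (norm h)\<^sup>2 + 2 * Re (\<Sum>m<N. \<Sum>n<m. cdot h (mpow Y (Suc n) *v h))"
proof -
  define g where "g m = (\<Sum>n<m. mpow Y n *v h)" for m
  have Yg: "Y *v g m = (\<Sum>n<m. mpow Y (Suc n) *v h)" for m
    by (simp add: g_def matrix_vector_mult_sum_right mpow_Suc_mult)
  have g_Suc: "g (Suc m) = h + Y *v g m" for m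
    unfolding Yg by (simp add: g_def sum.lessThan_Suc_shift mpow_0 del: sum.lessThan_Suc)
  have "(norm (g N))\<^sup>2 \<le> real N * (norm h)\<^sup>2 + 2 * Re (\<Sum>m<N. cdot h (Y *v g m))"
  proof (induction N)
    case 0
    then show ?case by (simp add: g_def)
  next
    case (Suc N)
    have "norm (Y *v g N) \<le> norm (g N)" using assms by (simp add: contraction_def)
    then have "(norm (Y *v g N))\<^sup>2 \<le> (norm (g N))\<^sup>2" by (rule power_mono) simp
    also note Suc
    finally show ?case unfolding g_Suc norm_add_square by (simp add: algebra_simps)
  qed
  moreover have "0 \<le> (norm (g N))\<^sup>2" by simp
  ultimately show ?thesis unfolding Yg cdot_sum_right by linarith
qed

text \<open>Collecting equal powers gives \<open>mpow Y k\<close> the weight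
  \<open>1 - k / N\<close> for \<open>0 < k < N\<close>: the Fejer kernel with a matrix in place of
  a point of the circle.\<close>

definition fejer :: "nat \<Rightarrow> complex^'n^'n \<Rightarrow> complex^'n^'n"
  where "fejer N Y = mat 1 + mscale (1 / of_nat N)
    (\<Sum>m<N. \<Sum>n<m. mpow Y (Suc n) + adj (mpow Y (Suc n)))"

lemma pos_semidef_fejer:
  fixes Y :: "complex^'n^'n"
  assumes "contraction Y" "N > 0"
  shows "pos_semidef (fejer N Y)"
proof -
  have "adj (fejer N Y) = fejer N Y"
    by (simp add: fejer_def adj_add adj_mscale adj_sum add.commute)
  moreover have "0 \<le> Re (cdot h (fejer N Y *v h))" for h
  proof -
    have "cdot h (adj A *v h) = cnj (cdot h (A *v h))" for A :: "complex^'n^'n"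
      by (simp add: cnj_cdot cdot_mult_left)
    then have "cdot h (fejer N Y *v h) = of_real ((norm h)\<^sup>2)
        + (\<Sum>m<N. \<Sum>n<m. of_real (2 * Re (cdot h (mpow Y (Suc n) *v h)))) / of_nat N"
      by (simp add: fejer_def matrix_vector_mult_add_rdistrib cdot_linear mscale_mult cdot_self
          matrix_vector_mult_sum_left cdot_sum_right complex_add_cnj del: of_real_mult)
    also have "\<dots> = of_real ((norm h)\<^sup>2 + 2 * Re (\<Sum>m<N. \<Sum>n<m. cdot h (mpow Y (Suc n) *v h)) / real N)"
      by (simp add: sum_distrib_left)
    finally have "Re (cdot h (fejer N Y *v h))
        = (real N * (norm h)\<^sup>2 + 2 * Re (\<Sum>m<N. \<Sum>n<m. cdot h (mpow Y (Suc n) *v h))) / real N"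
      using assms(2) by (simp add: add_divide_distrib)
    then show ?thesis using fejer_form_nonneg[OF assms(1), of N h] by simp
  qed
  ultimately show ?thesis by (simp add: pos_semidef_iff)
qed

section \<open>Averaging over roots of unity\<close>

lemma sum_roots_of_unity:
  assumes "0 < j" "j < M"
  shows "(\<Sum>k<M. cis (2 * pi * real k / real M) ^ j) = 0"
proof -
  \<comment> \<open>Interchanging the exponents turns the sum into a geometric one whose ratio
    \<open>z\<close> is an \<open>M\<close>-th root of unity other than 1.\<close>
  define z where "z = cis (2 * pi * real j / real M)"
  have eq: "cis (2 * pi * real k / real M) ^ j = z ^ k" for k
    unfolding z_def Complex.DeMoivre by (rule arg_cong[of _ _ cis]) simp
  have "z ^ M = 1" using assms by (simp add: z_def Complex.DeMoivre cis_multiple_2pi)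
  moreover have "z \<noteq> 1"
  proof
    assume "z = 1"
    then have "cos (2 * pi * real j / real M) = 1" by (simp add: z_def complex_eq_iff)
    then obtain x :: int where x: "2 * pi * real j / real M = of_int x * 2 * pi"
      using cos_one_2pi_int by blast
    then have eq: "real j / real M = of_int x" using assms by (simp add: field_simps)
    have "0 < real_of_int x" "real_of_int x < 1" unfolding eq[symmetric] using assms by simp_all
    then show False by simp
  qed
  ultimately show ?thesis by (simp add: eq sum_gp_strict)
qed

text \<open>Positivity is applied to the Fejer kernel of \<open>mscale (cnj w) X\<close> and
  averaged over roots of unity \<open>w\<close>. Of \<open>A0\<close> only the constant term
  survives. In \<open>A1\<close> the factor \<open>w\<close> cancels the \<open>cnj w\<close> at the
  first power of \<open>X\<close>, whose weight is \<open>K / Suc K\<close>.\<close>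

lemma averaging_contraction_approx:
  fixes A0 A1 :: "complex^'n^'n \<Rightarrow> complex"
  assumes add: "\<And>X Y. A0 (X + Y) = A0 X + A0 Y" "\<And>X Y. A1 (X + Y) = A1 X + A1 Y"
    and scale: "\<And>c X. A0 (mscale c X) = c * A0 X" "\<And>c X. A1 (mscale c X) = c * A1 X"
    and nonneg: "\<And>w F. cmod w = 1 \<Longrightarrow> pos_semidef F \<Longrightarrow> 0 \<le> Re (A0 F + w * A1 F)"
    and X: "contraction X"
  shows "0 \<le> Re (A0 (mat 1)) + real K / real (Suc K) * Re (A1 X)"
proof -
  \<comment> \<open>\<open>M\<close> exceeds every exponent that occurs, the largest being
    \<open>Suc (Suc n) \<le> N\<close>, so all nonconstant powers average to 0.\<close>
  define N M where "N = Suc K" and "M = Suc N"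
  have NM: "j < m \<Longrightarrow> m < N \<Longrightarrow> Suc (Suc j) < M" for j m by (simp add: M_def)
  define w where "w k = cis (2 * pi * real k / real M)" for k
  define Y where "Y k = mscale (cnj (w k)) X" for k
  have w: "cmod (w k) = 1" for k by (simp add: w_def)
  have ww: "w k * cnj (w k) = 1" for k using complex_norm_square[of "w k"] by (simp add: w)
  have NM': "j < m \<Longrightarrow> m < N \<Longrightarrow> Suc j < M" "j < m \<Longrightarrow> m < N \<Longrightarrow> j < M" for j m by (simp_all add: M_def)
  have roots: "(\<Sum>k<M. w k ^ j) = 0" if "0 < j" "j < M" for j
    unfolding w_def by (rule sum_roots_of_unity[OF that])
  have roots': "(\<Sum>k<M. cnj (w k) ^ j) = 0" if "0 < j" "j < M" for j
    using arg_cong[OF roots[OF that], of cnj] by simp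
  have sum: "A0 (\<Sum>i\<in>I. f i) = (\<Sum>i\<in>I. A0 (f i))" "A1 (\<Sum>i\<in>I. f i) = (\<Sum>i\<in>I. A1 (f i))"
    if "finite I" for I :: "nat set" and f
    using that add scale[of 0] by (induction I) (simp_all add: mscale_def zero_vec_def)
  have contr: "contraction (Y k)" for k
    using X w[of k] by (simp add: contraction_def Y_def mscale_mult norm_scale_vec)
  have F0: "A0 (fejer N (Y k)) = A0 (mat 1) + (\<Sum>m<N. \<Sum>n<m.
      cnj (w k) ^ Suc n * A0 (mpow X (Suc n)) + w k ^ Suc n * A0 (adj (mpow X (Suc n)))) / of_nat N" for k
    by (simp add: fejer_def add scale sum Y_def mpow_mscale adj_mscale del: power_Suc)
  have F1: "w k * A1 (fejer N (Y k)) = w k * A1 (mat 1) + (\<Sum>m<N. \<Sum>n<m.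
      cnj (w k) ^ n * A1 (mpow X (Suc n)) + w k ^ Suc (Suc n) * A1 (adj (mpow X (Suc n)))) / of_nat N" for k
  proof -
    have "w k * A1 (fejer N (Y k)) = w k * A1 (mat 1) + (\<Sum>m<N. \<Sum>n<m.
      w k * (cnj (w k) ^ Suc n * A1 (mpow X (Suc n)) + w k ^ Suc n * A1 (adj (mpow X (Suc n))))) / of_nat N"
      unfolding sum_distrib_left[symmetric]
      by (simp add: fejer_def add scale sum Y_def mpow_mscale adj_mscale distrib_left del: power_Suc)
    moreover have "w k * (cnj (w k) ^ Suc n * a + w k ^ Suc n * b) = cnj (w k) ^ n * a + w k ^ Suc (Suc n) * b"
      for a b n
    proof -
      have "w k * (cnj (w k) ^ Suc n * a + w k ^ Suc n * b)
          = (w k * cnj (w k)) * cnj (w k) ^ n * a + w k ^ Suc (Suc n) * b"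
        by (simp add: algebra_simps)
      then show ?thesis by (simp only: ww mult_1_left)
    qed
    ultimately show ?thesis by simp
  qed
  have S0: "(\<Sum>k<M. A0 (fejer N (Y k))) = of_nat M * A0 (mat 1)"
  proof -
    have "(\<Sum>k<M. \<Sum>m<N. \<Sum>n<m.
      cnj (w k) ^ Suc n * A0 (mpow X (Suc n)) + w k ^ Suc n * A0 (adj (mpow X (Suc n))))
      = (\<Sum>m<N. \<Sum>n<m. (\<Sum>k<M. cnj (w k) ^ Suc n) * A0 (mpow X (Suc n))
          + (\<Sum>k<M. w k ^ Suc n) * A0 (adj (mpow X (Suc n))))"
      by (simp only: sum.swap[of _ _ "{..<M}"] sum.distrib sum_distrib_right)
    also have "\<dots> = 0"
      by (intro sum.neutral ballI) (auto simp: roots roots' NM' simp del: power_Suc)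
    finally show ?thesis
      by (simp add: F0 sum.distrib sum_divide_distrib[symmetric] del: power_Suc)
  qed
  have S1: "(\<Sum>k<M. w k * A1 (fejer N (Y k))) = of_nat M * (of_nat K / of_nat N * A1 X)"
  proof -
    have "(\<Sum>k<M. \<Sum>m<N. \<Sum>n<m.
      cnj (w k) ^ n * A1 (mpow X (Suc n)) + w k ^ Suc (Suc n) * A1 (adj (mpow X (Suc n))))
      = (\<Sum>m<N. \<Sum>n<m. (\<Sum>k<M. cnj (w k) ^ n) * A1 (mpow X (Suc n))
          + (\<Sum>k<M. w k ^ Suc (Suc n)) * A1 (adj (mpow X (Suc n))))"
      by (simp only: sum.swap[of _ _ "{..<M}"] sum.distrib sum_distrib_right)
    also have "\<dots> = (\<Sum>m<N. \<Sum>n<m. if n = 0 then of_nat M * A1 X else 0)"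
      by (intro sum.cong refl) (auto simp: roots roots' NM NM' mpow_1 simp del: power_Suc)
    \<comment> \<open>The index \<open>n = 0\<close> occurs for every \<open>m\<close> except
      \<open>m = 0\<close>, hence \<open>K\<close> times.\<close>
    also have "\<dots> = (\<Sum>m<Suc K. if m = 0 then 0 else of_nat M * A1 X)"
      unfolding N_def by (intro sum.cong refl) (simp add: sum.delta)
    also have "\<dots> = of_nat K * of_nat M * A1 X"
      unfolding sum.lessThan_Suc_shift by simp
    finally have "(\<Sum>k<M. \<Sum>m<N. \<Sum>n<m.
      cnj (w k) ^ n * A1 (mpow X (Suc n)) + w k ^ Suc (Suc n) * A1 (adj (mpow X (Suc n))))
      = of_nat K * of_nat M * A1 X" .
    moreover have "(\<Sum>k<M. w k) = 0" using roots[of 1] by (simp add: M_def N_def)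
    ultimately show ?thesis
      by (simp add: F1 sum.distrib sum_divide_distrib[symmetric] sum_distrib_right[symmetric] del: power_Suc)
  qed
  have "0 \<le> Re (\<Sum>k<M. A0 (fejer N (Y k)) + w k * A1 (fejer N (Y k)))"
    unfolding Re_sum
    by (intro sum_nonneg nonneg w pos_semidef_fejer contr) (simp add: N_def)
  also have "(\<Sum>k<M. A0 (fejer N (Y k)) + w k * A1 (fejer N (Y k)))
      = of_real (real M) * (A0 (mat 1) + of_real (real K / real N) * A1 X)"
    by (simp add: sum.distrib S0 S1 distrib_left)
  finally have "0 \<le> real M * (Re (A0 (mat 1)) + real K / real N * Re (A1 X))"
    by (simp only: times_complex.simps plus_complex.simps Re_complex_of_real Im_complex_of_real) simp
  then show ?thesis by (simp add: zero_le_mult_iff M_def N_def)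
qed

lemma averaging_contraction:
  fixes A0 A1 :: "complex^'n^'n \<Rightarrow> complex"
  assumes "\<And>X Y. A0 (X + Y) = A0 X + A0 Y" "\<And>X Y. A1 (X + Y) = A1 X + A1 Y"
    and "\<And>c X. A0 (mscale c X) = c * A0 X" "\<And>c X. A1 (mscale c X) = c * A1 X"
    and "\<And>w F. cmod w = 1 \<Longrightarrow> pos_semidef F \<Longrightarrow> 0 \<le> Re (A0 F + w * A1 F)"
    and "contraction X"
  shows "0 \<le> Re (A0 (mat 1)) + Re (A1 X)"
proof -
  have "(\<lambda>K. Re (A0 (mat 1)) + real K / real (Suc K) * Re (A1 X)) \<longlonglongrightarrow> Re (A0 (mat 1)) + 1 * Re (A1 X)"
    by (intro tendsto_intros LIMSEQ_n_over_Suc_n)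
  from LIMSEQ_le_const[OF this] averaging_contraction_approx[OF assms] show ?thesis by simp
qed


subsection \<open>Orthonormal bases\<close>

definition orthonormal_on :: "'n set \<Rightarrow> ('n \<Rightarrow> complex^'n) \<Rightarrow> bool"
  where "orthonormal_on S e \<longleftrightarrow> (\<forall>i\<in>S. \<forall>j\<in>S. cdot (e i) (e j) = (if i = j then 1 else 0))"

text \<open>The matrix with the conjugated \<open>e i\<close> as rows over \<open>S\<close> has a
  zero row at \<open>k\<close>, so it is singular; a normalised kernel vector serves.\<close>

lemma exists_orthogonal_unit_vector:
  fixes e :: "'n::finite \<Rightarrow> complex^'n"
  assumes "k \<notin> S"
  shows "\<exists>x. norm x = 1 \<and> (\<forall>j\<in>S. cdot (e j) x = 0)"
proof -
  define M :: "complex^'n^'n" where "M = (\<chi> i j. if i \<in> S then cnj (e i $ j) else 0)"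
  have M: "(M *v x) $ i = (if i \<in> S then cdot (e i) x else 0)" for x i
    by (simp add: M_def matrix_vector_mult_def cdot_def)
  have "row k M = 0" using assms by (simp add: M_def row_def vec_eq_iff)
  then have "det M = 0" by (rule det_zero_row)
  then have "\<not> invertible M" by (simp add: invertible_det_nz)
  then obtain x where x: "x \<noteq> 0" "M *v x = 0"
    by (auto simp: invertible_left_inverse matrix_left_invertible_ker)
  have "cdot (e j) x = 0" if "j \<in> S" for j
    using M[of x j] that by (simp add: x(2))
  then show ?thesis
    using x(1) by (intro exI[of _ "of_real (1 / norm x) *s x"]) (simp add: norm_scale_vec norm_divide cdot_linear)
qed

lemma orthonormal_extension:
  fixes e :: "'n::finite \<Rightarrow> complex^'n"
  assumes "orthonormal_on S e"
  shows "\<exists>e'. orthonormal_on UNIV e' \<and> (\<forall>j\<in>S. e' j = e j)"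
  using assms
proof (induction "card (- S)" arbitrary: S e rule: less_induct)
  case less
  show ?case
  proof (cases "S = UNIV")
    case True
    then show ?thesis using less.prems by blast
  next
    case False
    then obtain k where k: "k \<notin> S" by blast
    obtain x where x: "norm x = 1" "\<And>j. j \<in> S \<Longrightarrow> cdot (e j) x = 0"
      using exists_orthogonal_unit_vector[OF k, of e] by blast
    have x': "cdot x (e j) = 0" if "j \<in> S" for j
      using arg_cong[OF x(2)[OF that], of cnj] by (simp add: cnj_cdot)
    have "cdot x x = 1" by (simp add: cdot_self x(1))
    then have "orthonormal_on (insert k S) (e(k := x))"
      using less.prems k x(2) x' unfolding orthonormal_on_def by auto
    moreover have "card (- insert k S) < card (- S)"
      using k by (intro psubset_card_mono) auto
    ultimately obtain e' where "orthonormal_on UNIV e'" "\<forall>j\<in>insert k S. e' j = (e(k := x)) j"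
      using less.hyps by blast
    then show ?thesis using k by (intro exI[of _ e']) (metis fun_upd_other insertCI)
  qed
qed

lemma exists_orthonormal: "\<exists>e :: 'n::finite \<Rightarrow> complex^'n. orthonormal_on UNIV e"
  using orthonormal_extension[of "{}"] by (auto simp: orthonormal_on_def)

lemma orthonormal_norm:
  assumes "orthonormal_on UNIV e"
  shows "norm (e a) = 1"
proof -
  have "complex_of_real ((norm (e a))\<^sup>2) = of_real 1"
    using assms unfolding cdot_self[symmetric] by (simp add: orthonormal_on_def)
  then have "(norm (e a))\<^sup>2 = 1\<^sup>2" unfolding of_real_eq_iff by simp
  then show ?thesis by (simp only: power2_eq_iff_nonneg norm_ge_zero zero_le_one)
qed

text \<open>The matrix with columns \<open>e j\<close> has its adjoint as left inverse, hence as
  right inverse.\<close>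

lemma orthonormal_complete:
  fixes e :: "'n::finite \<Rightarrow> complex^'n"
  assumes "orthonormal_on UNIV e"
  shows "(\<Sum>j\<in>UNIV. cnj (e j $ r) *s e j) = axis r 1"
proof -
  define U :: "complex^'n^'n" where "U = (\<chi> a j. e j $ a)"
  have "adj U ** U = mat 1"
    using assms by (simp add: orthonormal_on_def U_def adj_def matrix_matrix_mult_def vec_eq_iff mat_def
        flip: cdot_def)
  then have "U ** adj U = mat 1" by (simp add: matrix_left_right_inverse)
  then have "(U ** adj U) $ a $ r = mat 1 $ a $ r" for a by simp
  then show ?thesis
    by (simp add: U_def adj_def matrix_matrix_mult_def vec_eq_iff mat_def axis_def mult.commute)
qed

text \<open>Basis independence of the trace, for the basis of rank-one matrices
  \<open>outer (e k) (e j)\<close>: both standard basis vectors of an entry are expanded in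
  \<open>e\<close>.\<close>

lemma op_trace_orthonormal:
  fixes L :: "complex^'n^'n \<Rightarrow> complex^'n^'n"
  assumes L: "complex_linear L" and e: "orthonormal_on UNIV e"
  shows "op_trace L = (\<Sum>j\<in>UNIV. \<Sum>k\<in>UNIV. cdot (e k) (L (outer (e k) (e j)) *v e j))"
proof -
  have entry: "M $ p $ r = (\<Sum>j\<in>UNIV. \<Sum>k\<in>UNIV. cdot (e k) (mscale (e k $ p * cnj (e j $ r)) M *v e j))"
    for M :: "complex^'n^'n" and p r
  proof -
    have "M $ p $ r = cdot (\<Sum>k\<in>UNIV. cnj (e k $ p) *s e k) (M *v (\<Sum>j\<in>UNIV. cnj (e j $ r) *s e j))"
      unfolding orthonormal_complete[OF e] by (rule matrix_entry)
    also have "\<dots> = (\<Sum>j\<in>UNIV. cdot (\<Sum>k\<in>UNIV. cnj (e k $ p) *s e k) (M *v (cnj (e j $ r) *s e j)))"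
      by (simp only: matrix_vector_mult_sum_right cdot_sum_right)
    also have "\<dots> = (\<Sum>j\<in>UNIV. cnj (cdot (M *v (cnj (e j $ r) *s e j)) (\<Sum>k\<in>UNIV. cnj (e k $ p) *s e k)))"
      by (simp only: cnj_cdot)
    also have "\<dots> = (\<Sum>j\<in>UNIV. \<Sum>k\<in>UNIV. cdot (e k) (mscale (e k $ p * cnj (e j $ r)) M *v e j))"
      by (simp add: cdot_sum_right cdot_linear matrix_scale_mult mscale_mult cnj_cdot mult_ac)
    finally show ?thesis .
  qed
  have "op_trace L = (\<Sum>q\<in>UNIV. L (mat_unit q) $ fst q $ snd q)"
    by (simp add: op_trace_def trace_def op_matrix_def)
  also have "\<dots> = (\<Sum>q\<in>UNIV. \<Sum>j\<in>UNIV. \<Sum>k\<in>UNIV.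
      cdot (e k) (mscale (e k $ fst q * cnj (e j $ snd q)) (L (mat_unit q)) *v e j))"
    by (intro sum.cong refl entry)
  also have "\<dots> = (\<Sum>j\<in>UNIV. \<Sum>k\<in>UNIV. \<Sum>q\<in>UNIV.
      cdot (e k) (mscale (e k $ fst q * cnj (e j $ snd q)) (L (mat_unit q)) *v e j))"
    by (subst sum.swap, intro sum.cong refl, rule sum.swap)
  also have "\<dots> = (\<Sum>j\<in>UNIV. \<Sum>k\<in>UNIV. cdot (e k) (L (outer (e k) (e j)) *v e j))"
    by (subst complex_linear_expand[OF L])
      (simp add: matrix_vector_mult_sum_left cdot_sum_right outer_def)
  finally show ?thesis .
qed


subsection \<open>Inequalities for the matrix coefficients of the generator\<close>

context two_positive_generator
begin

text \<open>For unit vectors, the diagonal entry of \<open>L\<close> at \<open>outer y x\<close> in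
  the Hilbert-Schmidt inner product; \<open>t\<^sub>j\<^sub>k\<close> is the real part of
  \<open>coef (e j) (e k)\<close>.\<close>

definition coef :: "complex^'n \<Rightarrow> complex^'n \<Rightarrow> complex"
  where "coef x y = cdot y (L (outer y x) *v x)"

lemma coef_eq_beta: "coef x y = \<beta> (outer y x) (outer x y)"
  by (simp add: coef_def trace_mult_outer)

lemma coef_commute: "coef y x = cnj (coef x y)"
  unfolding coef_def cnj_cdot cdot_mult_left by (subst hermitian_outer) simp

lemma Re_coef_commute: "Re (coef y x) = Re (coef x y)"
  by (subst coef_commute) simp

text \<open>Conditional positivity with a single block: the projection
  \<open>mat 1 - outer x x\<close> annihilates \<open>x\<close>, and the identity pairs to 0 by
  \<open>trace_L\<close>.\<close>

lemma coef_diag_nonpos: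
  assumes "norm x = 1"
  shows "Re (coef x x) \<le> 0"
proof -
  have eq: "Re (cdot z ((mat 1 - outer x x) *v z)) = (norm z)\<^sup>2 - (cmod (cdot x z))\<^sup>2" for z
  proof -
    have "cdot z x * cdot x z = of_real ((cmod (cdot x z))\<^sup>2)"
      by (simp add: complex_norm_square cnj_cdot mult.commute del: of_real_power)
    then show ?thesis
      by (simp add: matrix_vector_mult_diff_rdistrib cdot_linear outer_mult cdot_self mult.commute
          del: of_real_power)
  qed
  have cs: "(cmod (cdot x z))\<^sup>2 \<le> (norm z)\<^sup>2" for z
  proof -
    have "0 \<le> (norm (z - cdot x z *s x))\<^sup>2" by simp
    also have "\<dots> = (norm z)\<^sup>2 - (cmod (cdot x z))\<^sup>2"
    proof -
      have "Re (cdot z (cdot x z *s x)) = (cmod (cdot x z))\<^sup>2"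
        by (metis Re_complex_of_real cdot_scale_right cnj_cdot complex_norm_square)
      then show ?thesis by (simp add: norm_diff_square norm_scale_vec assms)
    qed
    finally show ?thesis by simp
  qed
  have "0 \<le> Re (\<beta> (outer x x) (mat 1 - outer x x)) + Re (\<beta> (outer 0 0) 0) + 2 * Re (\<beta> (outer 0 x) 0)"
    by (rule conditional_two_positivity)
      (use cs assms in \<open>simp_all add: eq adj_diff adj_outer cdot_linear cdot_self,
        simp_all add: adj_def vec_eq_iff\<close>)
  moreover have "\<beta> A 0 = 0" for A by (simp add: trace_def)
  ultimately show ?thesis by (simp add: trace_linear(4) trace_L trace_mult_outer coef_def)
qed

text \<open>The test matrix is the rank-one block matrix of \<open>(x, - y)\<close>, which
  annihilates \<open>(x, y)\<close> because both norms are 1.\<close>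

lemma coef_off_diag_le:
  assumes "norm x = 1" "norm y = 1"
  shows "2 * Re (coef x y) \<le> Re (coef x x) + Re (coef y y)"
proof -
  have eq: "Re (cdot z (outer x x *v z)) + Re (cdot z' (outer y y *v z'))
      + 2 * Re (cdot z (mscale (-1) (outer x y) *v z')) = (cmod (cdot x z - cdot y z'))\<^sup>2" for z z'
  proof -
    have "cdot z (outer a b *v z') = cnj (cdot a z) * cdot b z'" for a b z z' :: "complex^'n"
      by (simp add: outer_mult cdot_linear cnj_cdot mult.commute)
    then show ?thesis
      unfolding cmod_power2 by (simp add: mscale_mult cdot_linear power2_eq_square algebra_simps)
  qed
  have "0 \<le> Re (\<beta> (outer x x) (outer x x)) + Re (\<beta> (outer y y) (outer y y))
      + 2 * Re (\<beta> (outer y x) (mscale (-1) (outer x y)))"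
    by (rule conditional_two_positivity) (simp_all add: eq adj_outer, simp add: cdot_self assms)
  then show ?thesis by (simp add: trace_linear coef_eq_beta)
qed

text \<open>As \<open>X *v v = u\<close> and \<open>adj X *v u = v\<close>, the block
  \<open>X - outer u v\<close> is \<open>X\<close> compressed to the complements of \<open>u\<close>
  and \<open>v\<close>. The form therefore dominates the square of a difference of norms, and it
  vanishes at \<open>(u, v)\<close>.\<close>

lemma eigenvalue_pair_bound:
  assumes X: "contraction X" and uv: "X *v v = u" "adj X *v u = v" "norm u = 1" "norm v = 1"
    and eig: "\<beta> (outer v u) X = \<mu>"
  shows "Re (coef u u) + Re (coef v v) + 2 * Re (coef u v) \<le> 2 * Re \<mu>"
proof -
  define Q where "Q a x = x - cdot a x *s a" for a x :: "complex^'n"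
  have Q: "Re (cdot x ((mat 1 - outer a a) *v x)) = (norm (Q a x))\<^sup>2" if "norm a = 1" for a x
  proof -
    have *: "cdot x a * cdot a x = of_real ((cmod (cdot a x))\<^sup>2)"
      by (simp add: complex_norm_square cnj_cdot mult.commute del: of_real_power)
    have "Re (cdot x (cdot a x *s a)) = (cmod (cdot a x))\<^sup>2"
      using * by (simp add: cdot_linear mult.commute del: of_real_power)
    then show ?thesis
      using that * by (simp add: Q_def norm_diff_square norm_scale_vec
          matrix_vector_mult_diff_rdistrib cdot_linear outer_mult cdot_self mult.commute del: of_real_power)
  qed
  have B: "cdot x ((X - outer u v) *v y) = cdot (Q u x) (X *v Q v y)" for x y
  proof -
    have "cdot u (X *v y) = cdot v y" by (simp add: cdot_mult_right uv)
    then show ?thesis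
      using uv by (simp add: Q_def matrix_vector_mult_diff_rdistrib matrix_vector_mult_diff_distrib
          matrix_scale_mult outer_mult cdot_linear cnj_cdot cdot_self)
  qed
  have nonneg: "0 \<le> Re (cdot x ((mat 1 - outer u u) *v x)) + Re (cdot y ((mat 1 - outer v v) *v y))
      + 2 * Re (cdot x ((X - outer u v) *v y))" for x y
  proof -
    let ?p = "norm (Q u x)" and ?q = "norm (Q v y)"
    have "- Re (cdot (Q u x) (X *v Q v y)) \<le> ?p * norm (X *v Q v y)"
      using Cauchy_Schwarz_ineq2[of "Q u x" "X *v Q v y"] by (simp add: Re_cdot)
    also have "\<dots> \<le> ?p * ?q" using X by (simp add: contraction_def mult_left_mono)
    finally have "?p\<^sup>2 + ?q\<^sup>2 + 2 * Re (cdot (Q u x) (X *v Q v y)) \<ge> (?p - ?q)\<^sup>2"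
      by (simp add: power2_diff)
    moreover have "(?p - ?q)\<^sup>2 \<ge> 0" by simp
    ultimately show ?thesis unfolding Q[OF uv(3)] Q[OF uv(4)] B by linarith
  qed
  have "Q u u = 0" "Q v v = 0" using uv by (simp_all add: Q_def cdot_self)
  then have zero: "Re (cdot u ((mat 1 - outer u u) *v u)) + Re (cdot v ((mat 1 - outer v v) *v v))
      + 2 * Re (cdot u ((X - outer u v) *v v)) = 0"
    unfolding Q[OF uv(3)] Q[OF uv(4)] B by (simp add: cdot_linear)
  have "0 \<le> Re (\<beta> (outer u u) (mat 1 - outer u u)) + Re (\<beta> (outer v v) (mat 1 - outer v v))
      + 2 * Re (\<beta> (outer v u) (X - outer u v))"
    by (rule conditional_two_positivity[OF _ _ nonneg zero]) (simp_all add: adj_diff adj_outer)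
  then show ?thesis by (simp add: trace_linear(4) trace_L coef_eq_beta eig)
qed

text \<open>For positive semi-definite \<open>F\<close>, \<open>form e F y y\<close> has the real part that conditional 2-positivity
  assigns to the vector \<open>(y, e)\<close> and the block matrix \<open>G F G\<^sup>*\<close>, where \<open>G\<close> is the column with entries \<open>1\<close>
  and \<open>- e y\<^sup>*\<close>. It is written so as to be complex linear in \<open>F\<close>.\<close>

definition form :: "complex^'n \<Rightarrow> complex^'n^'n \<Rightarrow> complex^'n \<Rightarrow> complex^'n \<Rightarrow> complex"
  where "form e F x y = \<beta> (outer y x) F + coef e e * cdot x (F *v y)
    - cdot e (L (outer e x) *v (F *v y)) - cdot x (F *v (L (outer y e) *v e))"

lemma form_hermitian:
  assumes "adj F = F"
  shows "form e F y x = cnj (form e F x y)"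
proof -
  have "\<beta> (outer x y) F = cnj (\<beta> (outer y x) F)" using beta_hermitian[of x y F] assms by simp
  moreover have "cdot y (F *v x) = cnj (cdot x (F *v y))" by (simp add: cnj_cdot cdot_mult_left assms)
  moreover have "cdot e (L (outer e y) *v (F *v x)) = cnj (cdot x (F *v (L (outer y e) *v e)))" for x y
    by (simp add: cnj_cdot cdot_mult_left assms) (simp add: hermitian_outer[of e y])
  moreover have "cnj (coef e e) = coef e e" by (rule coef_commute[symmetric])
  ultimately show ?thesis unfolding form_def by simp
qed

lemma form_nonneg:
  assumes F: "pos_semidef F" and e: "norm e = 1"
  shows "0 \<le> Re (form e F y y)"
proof -
  have herm: "adj F = F" and pos: "0 \<le> Re (cdot z (F *v z))" for z
    using F by (simp_all add: pos_semidef_iff)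
  define \<kappa> where "\<kappa> = cdot y (F *v y)"
  have \<kappa>: "cnj \<kappa> = \<kappa>" by (simp add: \<kappa>_def cnj_cdot cdot_mult_left herm)
  \<comment> \<open>The form of the block matrix is that of \<open>F\<close> at
    \<open>x - cdot e z *s y\<close>, the image of \<open>(x, z)\<close> under
    \<open>G\<^sup>*\<close>; this vector is 0 at \<open>(y, e)\<close>.\<close>
  have sq: "cdot x (F *v x) + cdot z (mscale \<kappa> (outer e e) *v z)
      + (cdot x (mscale (-1) (outer (F *v y) e) *v z) + cnj (cdot x (mscale (-1) (outer (F *v y) e) *v z)))
      = cdot (x - cdot e z *s y) (F *v (x - cdot e z *s y))" for x z
    by (simp add: matrix_vector_mult_diff_distrib matrix_scale_mult cdot_linear mscale_mult outer_mult
        cnj_cdot cdot_mult_left herm flip: \<kappa>_def) (simp add: cnj_cdot algebra_simps)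
  have re: "Re (cdot x (F *v x)) + Re (cdot z (mscale \<kappa> (outer e e) *v z))
      + 2 * Re (cdot x (mscale (-1) (outer (F *v y) e) *v z))
      = Re (cdot (x - cdot e z *s y) (F *v (x - cdot e z *s y)))" for x z
    unfolding sq[symmetric] by simp
  have "0 \<le> Re (\<beta> (outer y y) F) + Re (\<beta> (outer e e) (mscale \<kappa> (outer e e)))
      + 2 * Re (\<beta> (outer e y) (mscale (-1) (outer (F *v y) e)))"
  proof (rule conditional_two_positivity[OF herm])
    show "adj (mscale \<kappa> (outer e e)) = mscale \<kappa> (outer e e)"
      by (simp add: adj_mscale adj_outer \<kappa>)
    show "0 \<le> Re (cdot x (F *v x)) + Re (cdot z (mscale \<kappa> (outer e e) *v z))
      + 2 * Re (cdot x (mscale (-1) (outer (F *v y) e) *v z))" for x z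
      unfolding re by (rule pos)
    show "Re (cdot y (F *v y)) + Re (cdot e (mscale \<kappa> (outer e e) *v e))
      + 2 * Re (cdot y (mscale (-1) (outer (F *v y) e) *v e)) = 0"
      unfolding re by (simp add: cdot_self e cdot_linear)
  qed
  \<comment> \<open>Conditional positivity yields one cross term twice, whereas \<open>form\<close>
    contains it and its conjugate partner once each.\<close>
  moreover have "Re (cdot y (F *v (L (outer y e) *v e))) = Re (cdot e (L (outer e y) *v (F *v y)))"
  proof -
    have "cdot y (F *v (L (outer y e) *v e)) = cnj (cdot e (L (outer e y) *v (F *v y)))"
      by (simp add: cnj_cdot cdot_mult_left herm) (simp add: hermitian_outer[of y e] cdot_mult_right herm)
    then show ?thesis by simp
  qed
  ultimately show ?thesis
    by (simp add: form_def trace_linear trace_mult_outer mult.commute flip: \<kappa>_def coef_def)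
qed

lemma form_add_right: "form e F x (y + z) = form e F x y + form e F x z"
  and form_add_left: "form e F (x + y) z = form e F x z + form e F y z"
  and form_scale_right: "form e F x (c *s y) = c * form e F x y"
  and form_scale_left: "form e F (c *s x) y = cnj c * form e F x y"
  by (simp_all add: form_def outer_add_left outer_add_right outer_scale_left outer_scale_right
      L_add L_scale trace_linear cdot_linear matrix_vector_right_distrib matrix_vector_mult_add_rdistrib
      mscale_mult matrix_scale_mult) (simp_all add: algebra_simps)

lemma form_add_matrix: "form e (F + G) x y = form e F x y + form e G x y"
  and form_scale_matrix: "form e (mscale c F) x y = c * form e F x y"
  by (simp_all add: form_def trace_linear cdot_linear matrix_vector_right_distrib
      matrix_vector_mult_add_rdistrib mscale_mult matrix_scale_mult) (simp_all add: algebra_simps)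

text \<open>Positivity of the form at \<open>u + w *s v\<close> for all phases \<open>w\<close> is a
  condition on positive semi-definite \<open>F\<close>; averaging replaces \<open>F\<close> by the
  identity in the diagonal terms and by \<open>X\<close> in the cross term, where the eigenvalue
  appears.\<close>

lemma eigenvalue_third_vector_bound:
  assumes X: "contraction X" and uv: "X *v v = u" "adj X *v u = v" "norm u = 1" "norm v = 1"
    and eig: "\<beta> (outer v u) X = \<mu>" and e: "norm e = 1"
  shows "2 * (Re (coef u e) + Re (coef v e)) - 2 * Re (coef e e) \<le> Re \<mu>"
proof -
  have "0 \<le> Re (form e (mat 1) u u + form e (mat 1) v v) + Re (2 * form e X u v)"
  proof (rule averaging_contraction[OF _ _ _ _ _ X])
    fix w :: complex and F :: "complex^'n^'n"
    assume w: "cmod w = 1" and F: "pos_semidef F"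
    have ww: "cnj w * w = 1" using w complex_norm_square[of w] by (simp add: mult.commute)
    \<comment> \<open>The cross terms are conjugate, so their real part is that of one doubled term
      linear in \<open>w\<close>, as the averaging requires.\<close>
    have "form e F (u + w *s v) (u + w *s v)
        = form e F u u + (cnj w * w) * form e F v v + (w * form e F u v + cnj (w * form e F u v))"
      using form_hermitian[of F e v u] F
      by (simp add: form_add_left form_add_right form_scale_left form_scale_right pos_semidef_iff
          algebra_simps)
    then show "0 \<le> Re (form e F u u + form e F v v + w * (2 * form e F u v))"
      using form_nonneg[OF F e, of "u + w *s v"] by (simp add: ww)
  qed (simp_all add: form_add_matrix form_scale_matrix algebra_simps)
  moreover have "form e (mat 1) x x = coef e e - coef x e - coef e x" if "norm x = 1" for x
    using that by (simp add: form_def trace_L cdot_self coef_def)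
  moreover have "form e X u v = \<mu> + coef e e - coef u e - coef e v"
    using uv by (simp add: form_def eig cdot_self coef_def cdot_mult_right)
  ultimately show ?thesis
    using uv Re_coef_commute[of e u] Re_coef_commute[of e v] by simp
qed

end

section \<open>Summing the coefficient inequalities over a basis\<close>

lemma array_sum_le_diagonal:
  fixes r :: "'n::finite \<Rightarrow> 'n \<Rightarrow> real"
  assumes off: "\<And>a b. 2 * r a b \<le> r a a + r b b"
  shows "(\<Sum>a\<in>R. \<Sum>b\<in>R. r a b) \<le> card R * (\<Sum>a\<in>R. r a a)"
proof -
  have "(\<Sum>a\<in>R. \<Sum>b\<in>R. r a b) \<le> (\<Sum>a\<in>R. \<Sum>b\<in>R. (r a a + r b b) / 2)"
    using off by (intro sum_mono) (simp add: mult.commute)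
  also have "\<dots> = card R * (\<Sum>a\<in>R. r a a)"
    by (simp add: sum.distrib add_divide_distrib sum_distrib_left[symmetric] sum_divide_distrib[symmetric])
  finally show ?thesis .
qed

text \<open>The block of \<open>i\<close> and \<open>j\<close> contributes at most
  \<open>2 * l\<close>, each further index \<open>k\<close> at most \<open>l + 2 * r k k\<close>
  through its entries with \<open>i\<close> and \<open>j\<close>, and the remaining block at most
  its size times its diagonal sum. The diagonal terms are then dropped as nonpositive.\<close>

lemma symmetric_array_sum_le_pair:
  fixes r :: "'n::finite \<Rightarrow> 'n \<Rightarrow> real" and l :: real
  assumes sym: "\<And>a b. r a b = r b a" and off: "\<And>a b. 2 * r a b \<le> r a a + r b b"
    and diag: "\<And>a. r a a \<le> 0" and ij: "i \<noteq> j"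
    and pair: "r i i + r j j + 2 * r i j \<le> 2 * l"
    and third: "\<And>k. 2 * (r i k + r j k) - 2 * r k k \<le> l"
  shows "(\<Sum>a\<in>UNIV. \<Sum>b\<in>UNIV. r a b) \<le> CARD('n) * l"
proof -
  define R where "R = UNIV - {i, j}"
  have split: "(\<Sum>a\<in>UNIV. f a) = f i + f j + (\<Sum>a\<in>R. f a)" for f :: "'n \<Rightarrow> real"
    using ij sum.remove[of UNIV i f] sum.remove[of "UNIV - {i}" j f]
    by (simp add: R_def Diff_insert2[symmetric] insert_commute)
  have card: "real CARD('n) = 2 + real (card R)"
    using split[of "\<lambda>_. 1"] by simp
  have "(\<Sum>a\<in>UNIV. \<Sum>b\<in>UNIV. r a b) = r i i + r j j + 2 * r i j
      + (\<Sum>k\<in>R. 2 * (r i k + r j k)) + (\<Sum>a\<in>R. \<Sum>b\<in>R. r a b)"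
  proof -
    have "(\<Sum>a\<in>R. r a i) = (\<Sum>a\<in>R. r i a)" "(\<Sum>a\<in>R. r a j) = (\<Sum>a\<in>R. r j a)"
      by (intro sum.cong refl sym)+
    then show ?thesis
      unfolding split by (simp add: sum.distrib sym[of j i] sum_distrib_left[symmetric])
  qed
  also have "\<dots> \<le> 2 * l + (\<Sum>k\<in>R. l + 2 * r k k) + card R * (\<Sum>k\<in>R. r k k)"
  proof (intro add_mono pair array_sum_le_diagonal off sum_mono)
    show "2 * (r i k + r j k) \<le> l + 2 * r k k" for k using third[of k] by simp
  qed
  also have "\<dots> = CARD('n) * l + CARD('n) * (\<Sum>k\<in>R. r k k)"
    by (simp add: card sum.distrib sum_distrib_left[symmetric] algebra_simps)
  also have "\<dots> \<le> CARD('n) * l"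
    using diag by (simp add: mult_nonneg_nonpos sum_nonpos)
  finally show ?thesis .
qed


subsection \<open>Eigenvalues\<close>

lemma exists_left_eigenvector:
  fixes L :: "complex^'n^'n \<Rightarrow> complex^'n^'n"
  assumes L: "complex_linear L" and z: "z \<in> op_spectrum L"
  obtains X where "X \<noteq> 0" "\<And>A. trace (L A ** X) = z * trace (A ** X)"
proof -
  define M where "M = mat z - op_matrix L"
  have "det (transpose M) = 0"
    using z by (simp add: M_def op_spectrum_eq_roots[OF L] poly_op_charpoly)
  then have "\<not> invertible (transpose M)" by (simp only: invertible_det_nz)
  then obtain x where x: "x \<noteq> 0" "transpose M *v x = 0"
    by (auto simp: invertible_left_inverse matrix_left_invertible_ker)
  \<comment> \<open>The indices are swapped because \<open>trace (A ** X)\<close> pairs each entry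
    of \<open>A\<close> with the transposed entry of \<open>X\<close>.\<close>
  define X :: "complex^'n^'n" where "X = (\<chi> j i. x $ (i, j))"
  have tr: "trace (A ** X) = (\<Sum>p\<in>UNIV. x $ p * A $ fst p $ snd p)" for A
  proof -
    have "trace (A ** X) = (\<Sum>(i, j)\<in>UNIV. x $ (i, j) * A $ i $ j)"
      by (simp add: trace_mult X_def sum.cartesian_product mult.commute)
    then show ?thesis by (simp add: case_prod_beta)
  qed
  have "trace (L A ** X) = z * trace (A ** X)" for A
  proof -
    define a :: "complex^('n \<times> 'n)" where "a = (\<chi> p. A $ fst p $ snd p)"
    have Ma: "(M *v a) $ p = z * A $ fst p $ snd p - L A $ fst p $ snd p" for p
      unfolding M_def a_def matrix_vector_mult_diff_rdistrib op_matrix_mult[OF L]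
      by (simp add: matrix_vector_mult_def mat_def if_distrib if_distribR sum.delta cong: if_cong)
    have "z * trace (A ** X) - trace (L A ** X) = (\<Sum>p\<in>UNIV. x $ p * (M *v a) $ p)"
      unfolding tr Ma by (simp add: sum_distrib_left sum_subtractf right_diff_distrib mult_ac)
    also have "\<dots> = (\<Sum>p\<in>UNIV. \<Sum>q\<in>UNIV. x $ p * M $ p $ q * a $ q)"
      by (simp add: matrix_vector_mult_def sum_distrib_left mult.assoc)
    also have "\<dots> = (\<Sum>q\<in>UNIV. \<Sum>p\<in>UNIV. x $ p * M $ p $ q * a $ q)" by (rule sum.swap)
    also have "\<dots> = (\<Sum>q\<in>UNIV. (transpose M *v x) $ q * a $ q)"
      by (simp add: matrix_vector_mult_def transpose_def sum_distrib_left mult_ac)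
    also have "\<dots> = 0" unfolding x(2) by simp
    finally show ?thesis by simp
  qed
  moreover have "X \<noteq> 0" using x(1) by (auto simp: X_def vec_eq_iff)
  ultimately show thesis using that by blast
qed

section \<open>The two leading coefficients of the characteristic polynomial\<close>

text \<open>The induction for the last claim uses the leading coefficient, whose own step uses
  vanishing beyond the degree, so the three go together.\<close>

lemma coeff_prod_linear_factors:
  fixes a :: "'b \<Rightarrow> complex"
  assumes "finite S"
  shows "(\<forall>n>card S. coeff (\<Prod>p\<in>S. [:- a p, 1:]) n = 0) \<and> coeff (\<Prod>p\<in>S. [:- a p, 1:]) (card S) = 1 \<and>
    (\<forall>n. Suc n = card S \<longrightarrow> coeff (\<Prod>p\<in>S. [:- a p, 1:]) n = - (\<Sum>p\<in>S. a p))"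
  using assms
proof (induction S)
  case (insert x S)
  define P where "P = (\<Prod>p\<in>S. [:- a p, 1:])"
  have c: "coeff ([:- a x, 1:] * P) n = - a x * coeff P n + (case n of 0 \<Rightarrow> 0 | Suc m \<Rightarrow> coeff P m)" for n
    by (simp add: coeff_pCons)
  have "S = {}" if "card S = 0" using that insert.hyps by simp
  then show ?case
    using insert.IH insert.hyps unfolding P_def[symmetric]
    by (auto simp: c simp flip: P_def simp del: mult_pCons_left split: nat.splits)
qed simp

text \<open>A permutation other than the identity moves at least two indices, so its summand has
  degree at most \<open>CARD('n)\<^sup>2 - 2\<close> and leaves both coefficients to the product of
  the diagonal entries.\<close>

lemma op_charpoly_subleading:
  fixes L :: "complex^'n^'n \<Rightarrow> complex^'n^'n"
  shows "coeff (op_charpoly L) (CARD('n)\<^sup>2) = 1"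
    and "coeff (op_charpoly L) (CARD('n)\<^sup>2 - 1) = - op_trace L"
proof -
  define M :: "complex poly^('n \<times> 'n)^('n \<times> 'n)"
    where "M = mat [:0, 1:] - (\<chi> p q. [:op_matrix L $ p $ q:])"
  define T where "T \<pi> = of_int (sign \<pi>) * (\<Prod>p\<in>UNIV. M $ p $ \<pi> p)" for \<pi> :: "'n \<times> 'n \<Rightarrow> 'n \<times> 'n"
  let ?P = "{\<pi>. \<pi> permutes (UNIV :: ('n \<times> 'n) set)}"
  let ?N = "CARD('n \<times> 'n)"
  have M: "M $ p $ q = (if p = q then [:- op_matrix L $ p $ q, 1:] else [:- op_matrix L $ p $ q:])" for p q
    by (simp add: M_def mat_def)
  have Tid: "T id = (\<Prod>p\<in>UNIV. [:- op_matrix L $ p $ p, 1:])"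
    by (simp add: T_def M sign_id)
  have other: "degree (T \<pi>) + 2 \<le> ?N" if "\<pi> permutes UNIV" "\<pi> \<noteq> id" for \<pi>
  proof -
    obtain a where a: "\<pi> a \<noteq> a" using \<open>\<pi> \<noteq> id\<close> by (auto simp: fun_eq_iff)
    have "\<pi> (\<pi> a) \<noteq> \<pi> a" using a permutes_inj[OF that(1)] by (auto dest: injD)
    then have sub: "{p. \<pi> p = p} \<subseteq> UNIV - {a, \<pi> a}" using a by auto
    have "degree (T \<pi>) \<le> degree (\<Prod>p\<in>UNIV. M $ p $ \<pi> p)"
      unfolding T_def by (rule order_trans[OF degree_mult_le]) simp
    also have "\<dots> \<le> (\<Sum>p\<in>UNIV. degree (M $ p $ \<pi> p))"
      using degree_prod_sum_le[of UNIV "\<lambda>p. M $ p $ \<pi> p"] by (simp add: o_def)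
    also have "\<dots> \<le> (\<Sum>p\<in>UNIV. if \<pi> p = p then 1 else 0)"
      by (intro sum_mono) (auto simp: M)
    also have "\<dots> = card {p. \<pi> p = p}" by (simp add: sum.If_cases)
    also have "\<dots> \<le> card (UNIV - {a, \<pi> a})" by (intro card_mono sub) simp
    also have "\<dots> = ?N - 2" using a by (subst card_Diff_subset) auto
    finally have "degree (T \<pi>) \<le> ?N - 2" .
    moreover have "card {a, \<pi> a} \<le> ?N" by (intro card_mono) simp_all
    ultimately show ?thesis using a by simp
  qed
  have eq: "op_charpoly L = T id + (\<Sum>\<pi>\<in>?P - {id}. T \<pi>)"
  proof -
    have "op_charpoly L = (\<Sum>\<pi>\<in>?P. T \<pi>)"
      by (simp add: op_charpoly_def det_def T_def M_def)
    then show ?thesis by (subst (asm) sum.remove[of _ id]) (auto simp: permutes_id)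
  qed
  have coeff_eq: "coeff (op_charpoly L) n = coeff (T id) n" if "?N \<le> Suc n" for n
  proof -
    have "coeff (T \<pi>) n = 0" if "\<pi> \<in> ?P - {id}" for \<pi>
      using other[of \<pi>] that \<open>?N \<le> Suc n\<close> by (intro coeff_eq_0) auto
    then have "(\<Sum>\<pi>\<in>?P - {id}. coeff (T \<pi>) n) = 0" by (intro sum.neutral) blast
    then show ?thesis by (simp add: eq coeff_sum)
  qed
  have N: "?N = CARD('n)\<^sup>2" by (simp add: power2_eq_square)
  have "0 < CARD('n)" by simp
  then have pos: "Suc (CARD('n)\<^sup>2 - 1) = CARD('n)\<^sup>2" by simp
  note lin = coeff_prod_linear_factors[of "UNIV :: ('n \<times> 'n) set" "\<lambda>p. op_matrix L $ p $ p",
      OF finite, folded Tid, unfolded N]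
  show "coeff (op_charpoly L) (CARD('n)\<^sup>2) = 1"
    using lin coeff_eq[of "CARD('n)\<^sup>2"] unfolding N by simp
  show "coeff (op_charpoly L) (CARD('n)\<^sup>2 - 1) = - op_trace L"
    using lin[THEN conjunct2, THEN conjunct2, rule_format, OF pos] coeff_eq[of "CARD('n)\<^sup>2 - 1"] pos
    unfolding N op_trace_def trace_def by simp
qed

text \<open>Vieta: the coefficient below the leading one is read off from the factorisation and from
  the determinant.\<close>

lemma sum_eigenvalues_eq_op_trace:
  fixes L :: "complex^'n^'n \<Rightarrow> complex^'n^'n"
  assumes "image_mset ev (mset_set {1..CARD('n)\<^sup>2}) = op_eigenvalues L"
  shows "(\<Sum>k=1..CARD('n)\<^sup>2. ev k) = op_trace L"
proof -
  have "lead_coeff (op_charpoly L) = 1"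
    by (simp add: degree_op_charpoly op_charpoly_subleading)
  then have "op_charpoly L = (\<Prod>x\<in>#op_eigenvalues L. [:- x, 1:])"
    using complex_poly_decompose_multiset[of "op_charpoly L"] by (simp add: op_eigenvalues_def)
  also have "\<dots> = (\<Prod>k=1..CARD('n)\<^sup>2. [:- ev k, 1:])"
    unfolding assms[symmetric] by (simp add: prod_unfold_prod_mset image_mset.compositionality o_def)
  finally have eq: "op_charpoly L = (\<Prod>k=1..CARD('n)\<^sup>2. [:- ev k, 1:])" .
  have "0 < CARD('n)" by simp
  then have "coeff (op_charpoly L) (CARD('n)\<^sup>2 - 1) = - (\<Sum>k=1..CARD('n)\<^sup>2. ev k)"
    unfolding eq using coeff_prod_linear_factors[of "{1..CARD('n)\<^sup>2}" ev] by simp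
  then show ?thesis unfolding op_charpoly_subleading by simp
qed

section \<open>The trace bound for every eigenvalue\<close>

context two_positive_generator
begin

lemma op_trace_eq_sum_coef:
  assumes "orthonormal_on UNIV e"
  shows "op_trace L = (\<Sum>j\<in>UNIV. \<Sum>k\<in>UNIV. coef (e j) (e k))"
  using op_trace_orthonormal[OF complex_linear assms] by (simp add: coef_def)

lemma op_trace_real: "op_trace L \<in> \<real>"
proof -
  obtain e :: "'n \<Rightarrow> complex^'n" where e: "orthonormal_on UNIV e" using exists_orthonormal by blast
  have "cnj (op_trace L) = (\<Sum>j\<in>UNIV. \<Sum>k\<in>UNIV. coef (e k) (e j))"
    unfolding op_trace_eq_sum_coef[OF e] cnj_sum by (intro sum.cong refl coef_commute[symmetric])
  also have "\<dots> = op_trace L" unfolding op_trace_eq_sum_coef[OF e] by (rule sum.swap)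
  finally show ?thesis by (simp add: Reals_cnj_iff)
qed

text \<open>Serves the eigenvalue 0, the only one that can have a scalar left eigenvector.\<close>

lemma op_trace_nonpos: "Re (op_trace L) \<le> 0"
proof -
  obtain e :: "'n \<Rightarrow> complex^'n" where e: "orthonormal_on UNIV e" using exists_orthonormal by blast
  have "Re (op_trace L) \<le> CARD('n) * (\<Sum>a\<in>UNIV. Re (coef (e a) (e a)))"
    unfolding op_trace_eq_sum_coef[OF e] Re_sum
    by (intro array_sum_le_diagonal coef_off_diag_le orthonormal_norm[OF e])
  also have "\<dots> \<le> 0"
    by (intro mult_nonneg_nonpos sum_nonpos coef_diag_nonpos orthonormal_norm[OF e]) simp
  finally show ?thesis .
qed

lemma op_trace_le_eigenvalue:
  assumes z: "z \<in> op_spectrum L"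
  shows "Re (op_trace L) \<le> real CARD('n) * Re z"
proof -
  obtain X where X: "X \<noteq> 0" "\<And>A. \<beta> A X = z * trace (A ** X)"
    using exists_left_eigenvector[OF complex_linear z] by metis
  show ?thesis
  proof (cases "\<exists>c. X = mscale c (mat 1)")
    case True
    then obtain c where c: "X = mscale c (mat 1)" by blast
    have "c \<noteq> 0" using X(1) c by (auto simp: mscale_def vec_eq_iff)
    \<comment> \<open>Evaluated at the identity, the left side of the eigenvector equation is a
      multiple of the trace of \<open>L (mat 1)\<close>, which is 0.\<close>
    moreover have "z * (c * trace (mat 1 :: complex^'n^'n)) = 0"
      using X(2)[of "mat 1"] unfolding c trace_linear by (simp add: trace_L)
    moreover have "trace (mat 1 :: complex^'n^'n) \<noteq> 0" by (simp add: trace_def mat_def)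
    ultimately have "z = 0" by simp
    then show ?thesis using op_trace_nonpos by simp
  next
    case False
    then obtain c s where s: "s > 0" and T: "contraction (mscale (of_real (1 / s)) (X - mscale c (mat 1)))"
      and min: "\<And>z. \<exists>v. norm v = 1 \<and>
        1 \<le> norm ((mscale (of_real (1 / s)) (X - mscale c (mat 1)) - mscale z (mat 1)) *v v)"
      using exists_nearest_scalar[of X] by metis
    define T where "T = mscale (of_real (1 / s)) (X - mscale c (mat 1))"
    have contr: "contraction T" using T by (simp add: T_def)
    obtain v where v: "norm v = 1" "norm (T *v v) = 1" "cdot v (T *v v) = 0"
      using exists_maximal_vector_orthogonal[OF T min] unfolding T_def by blast
    define u where "u = T *v v"
    have u: "norm u = 1" "T *v v = u" "adj T *v u = v" "cdot v u = 0"
      using v contraction_isometric_vector[OF contr, of v] by (simp_all add: u_def)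
    have uv: "cdot u v = 0" using arg_cong[OF u(4), of cnj] by (simp add: cnj_cdot)
    have Xv: "X *v v = of_real s *s u + c *s v"
      using s unfolding u_def T_def
      by (simp add: mscale_mult matrix_vector_mult_diff_rdistrib vec_eq_iff)
    have "\<beta> (outer v u) X = z * cdot u (X *v v)"
      by (simp add: X(2) trace_mul_sym[of "outer v u"] trace_mult_outer)
    also have "cdot u (X *v v) = of_real s" by (simp add: Xv cdot_linear uv cdot_self u(1))
    \<comment> \<open>The shift by \<open>c\<close> contributes nothing because \<open>L\<close> has
      traceless values, and the factor \<open>s\<close> cancels the normalisation.\<close>
    finally have eig: "\<beta> (outer v u) T = z"
      using s by (simp add: T_def trace_linear trace_L)
    \<comment> \<open>Orthogonal unit vectors force dimension at least two.\<close>
    obtain i j :: 'n where ij: "i \<noteq> j"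
    proof (rule ccontr)
      assume "\<not> thesis"
      then have U: "UNIV = {undefined :: 'n}" using that by blast
      have "cdot v u = cnj (v $ undefined) * u $ undefined" unfolding cdot_def U by simp
      then have "v $ undefined = 0 \<or> u $ undefined = 0" using u(4) by simp
      moreover have "i = undefined" for i :: 'n using U by blast
      ultimately have "v = 0 \<or> u = 0" unfolding vec_eq_iff by (metis zero_index)
      then show False using u(1) v(1) by auto
    qed
    have "orthonormal_on {i, j} (\<lambda>k. if k = i then u else v)"
      using ij u(1,4) v(1) uv by (auto simp: orthonormal_on_def cdot_self)
    from orthonormal_extension[OF this]
    obtain e where e: "orthonormal_on UNIV e" "e i = u" "e j = v"
      using ij by auto
    note en = orthonormal_norm[OF e(1)]
    show ?thesis
      unfolding op_trace_eq_sum_coef[OF e(1)] Re_sum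
    proof (rule symmetric_array_sum_le_pair[OF _ _ _ ij])
      show "Re (coef (e i) (e i)) + Re (coef (e j) (e j)) + 2 * Re (coef (e i) (e j)) \<le> 2 * Re z"
        unfolding e(2,3) by (rule eigenvalue_pair_bound[OF contr u(2,3,1) v(1) eig])
      show "2 * (Re (coef (e i) (e k)) + Re (coef (e j) (e k))) - 2 * Re (coef (e k) (e k)) \<le> Re z" for k
        unfolding e(2,3) by (rule eigenvalue_third_vector_bound[OF contr u(2,3,1) v(1) eig en])
    qed (intro Re_coef_commute coef_off_diag_le coef_diag_nonpos en)+
  qed
qed

end

theorem theorem2:
  fixes L :: "complex^'n^'n \<Rightarrow> complex^'n^'n"
  assumes "complex_linear L"
    and "\<And>t::real. t \<ge> 0 \<Longrightarrow> two_positive (op_exp (\<lambda>X. t *\<^sub>R L X))"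
    and "\<And>t::real. t \<ge> 0 \<Longrightarrow> trace_preserving (op_exp (\<lambda>X. t *\<^sub>R L X))"
  shows "op_trace L \<in> \<real> \<and>
         Re (op_trace L) \<le> real CARD('n) * Min (Re ` op_spectrum L) \<and>
         (\<forall>ev :: nat \<Rightarrow> complex.
            image_mset ev (mset_set {1..CARD('n)\<^sup>2}) = op_eigenvalues L \<longrightarrow>
            (\<forall>j\<in>{1..CARD('n)\<^sup>2}.
               - Re (ev j) \<le> 1 / real CARD('n) * (\<Sum>k=1..CARD('n)\<^sup>2. - Re (ev k))))"
proof (intro conjI allI impI ballI)
  interpret two_positive_generator L using assms by unfold_locales
  show "op_trace L \<in> \<real>" by (rule op_trace_real)
  have "Min (Re ` op_spectrum L) \<in> Re ` op_spectrum L"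
    using op_spectrum_finite_nonempty[OF assms(1)] by (intro Min_in) simp_all
  then show "Re (op_trace L) \<le> real CARD('n) * Min (Re ` op_spectrum L)"
    using op_trace_le_eigenvalue by auto
  fix ev :: "nat \<Rightarrow> complex" and j
  assume ev: "image_mset ev (mset_set {1..CARD('n)\<^sup>2}) = op_eigenvalues L" and j: "j \<in> {1..CARD('n)\<^sup>2}"
  have "ev j \<in># op_eigenvalues L" unfolding ev[symmetric] using j by simp
  then have "Re (op_trace L) \<le> real CARD('n) * Re (ev j)"
    by (intro op_trace_le_eigenvalue) (simp add: op_spectrum_eq_eigenvalues[OF assms(1)])
  moreover have "(\<Sum>k=1..CARD('n)\<^sup>2. - Re (ev k)) = - Re (op_trace L)"
    unfolding sum_eigenvalues_eq_op_trace[OF ev, symmetric] by (simp add: sum_negf)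
  ultimately show "- Re (ev j) \<le> 1 / real CARD('n) * (\<Sum>k=1..CARD('n)\<^sup>2. - Re (ev k))"
    by (simp add: field_simps)
qed

end
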